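(* Let $G(V,E)$ be a trivalent graph with perfect matching $M\subset E$ and let $\Gamma_M$ be a perfect matching graph for the pair $(G,M)$. Then for every positive integer $n$, $T(\Gamma_M,n)=\{G,M\}$.
   Context: Graphs are finite multigraphs. A ribbon graph of $G$ is an embedding of $G$ into a compact surface with boundary that deformation retracts onto the image of $G$; a perfect matching graph $\Gamma_M$ is a ribbon graph of $G$ together with a perfect matching $M=\{e_1,\dots,e_\ell\}$ (each vertex incident to exactly one edge of $M$). Smoothings: for a matching edge $e=uv$ with other edge-ends $a,b$ at $u$ and $c,d$ at $v$, where $a$ and $c$ lie on the same side of $e$ in the ribbon structure, the $0$-smoothing deletes $e,u,v$ and joins $a$–$c$ and $b$–$d$ by two parallel arcs; the $1$-smoothing joins $a$–$d$ and $b$–$c$ by two arcs crossing once. For $\alpha\in\{0,1\}^\ell$ the state $\Gamma_\alpha$ is the collection of closed curves obtained by applying the $\alpha_i$-smoothing at each $e_i$; $k_\alpha$ is its number of curves and $|\alpha|=\sum\alpha_i$. Each matching edge $e_i$ gives rise to a pair of arcs in $\Gamma_\alpha$. Color bracket: $\{G,M\}=\sum_{\alpha\in\{0,1\}^\ell} N(\Gamma_\alpha)$, where $N(\Gamma_\alpha)$ is the number of assignments of colors from $\{1,\dots,n\}$ to the curves of $\Gamma_\alpha$ such that, for every matching edge, the two arcs produced by smoothing it lie on curves of different colors. (Equivalently, $\{G,M\}$ is the number of perfect matching $n$-colorings: colorings of the non-matching edges of $G$ with colors in $\{1,\dots,n\}$ such that exactly two distinct colors are used on the four edges adjacent to each matching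 edge and both colors appear at each end of the matching edge.) Total face color polynomial: with $\widehat V=\mathbb C[x]/(x^n-1)$, $m=n/2$ if $n$ even and $m=(n-1)/2$ if $n$ odd, chain groups $\widehat C^i(\Gamma_M)=\bigoplus_{|\alpha|=i}\widehat V^{\otimes k_\alpha}$, and differential the sum, with the standard Khovanov hypercube signs, over hypercube edges $\alpha\to\alpha'$ (one coordinate changed from $0$ to $1$) of the maps that are the identity on uninvolved curves and are $\widehat m(x^i\otimes x^j)=x^{i+j}$ if two curves merge, $\widehat\Delta(x^k)=\sum_{0\le i,j<n,\ i+j\equiv k+2m\ (\mathrm{mod}\ n)}x^i\otimes x^j$ if a curve splits, and $\widehat\eta(x^k)=\sqrt n\,x^{k+m}$ if the number of curves is unchanged. The filtered $n$-color homology is the homology of this complex, and $T(\Gamma_M,n)$ is its total dimension (the Poincaré polynomial evaluated at $t=1$). *)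

theory Defs
  imports Complex_Main "HOL-Library.FuncSet" "HOL-Library.Function_Algebras"
begin

text \<open>
A finite multigraph is given by a finite set of darts (half-edges) D, a fixed-point-free
involution alpha on D (pairing the two ends of each edge; loops allowed), and a map vert
sending each dart to its vertex. A ribbon graph structure (embedding into a possibly
non-orientable surface with boundary that retracts onto the graph) is given in the standard
combinatorial way by a rotation system sigma (the cyclic order of darts around each vertex)
together with an edge signature tw (twisted / untwisted band). The perfect matching
M = {e_1,...,e_l} is given as a list es: es!i is a chosen end of the matching edge e_i.
\<close>

definition matching_darts :: "('d \<Rightarrow> 'd) \<Rightarrow> 'd list \<Rightarrow> 'd set" where
  "matching_darts alpha es = set es \<union> alpha ` set es"

definition perfect_matching_graph ::
  "'d set \<Rightarrow> ('d \<Rightarrow> 'd) \<Rightarrow> ('d \<Rightarrow> 'v) \<Rightarrow> ('d \<Rightarrow> 'd) \<Rightarrow> ('d \<Rightarrow> bool) \<Rightarrow> 'd list \<Rightarrow> bool" where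
  "perfect_matching_graph D alpha vert sigma tw es \<longleftrightarrow>
     finite D
   \<and> (\<forall>h\<in>D. alpha h \<in> D \<and> alpha h \<noteq> h \<and> alpha (alpha h) = h)
   \<comment> \<open>trivalent\<close>
   \<and> (\<forall>h\<in>D. card {h'\<in>D. vert h' = vert h} = 3)
   \<comment> \<open>rotation system: a cyclic permutation of the darts at each vertex\<close>
   \<and> (\<forall>h\<in>D. sigma h \<in> D \<and> vert (sigma h) = vert h \<and> sigma h \<noteq> h \<and> sigma (sigma (sigma h)) = h)
   \<comment> \<open>edge signature (twisted bands)\<close>
   \<and> (\<forall>h\<in>D. tw (alpha h) = tw h)
   \<comment> \<open>perfect matching, each matching edge listed exactly once\<close>
   \<and> distinct es \<and> set es \<subseteq> D
   \<and> (\<forall>i<length es. \<forall>j<length es. alpha (es!i) \<noteq> es!j)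
   \<and> (\<forall>h\<in>D. card {h'\<in>matching_darts alpha es. vert h' = vert h} = 1)"

text \<open>For the matching edge with chosen end h = e_u at u (other end alpha h = e_v at v):
the other edge-ends a, b at u, and the ends c, d at v, where c lies on the same side of
the edge as a in the ribbon structure.\<close>

definition end_a :: "('d \<Rightarrow> 'd) \<Rightarrow> 'd \<Rightarrow> 'd" where
  "end_a sigma h = sigma h"
definition end_b :: "('d \<Rightarrow> 'd) \<Rightarrow> 'd \<Rightarrow> 'd" where
  "end_b sigma h = sigma (sigma h)"
definition end_c :: "('d \<Rightarrow> 'd) \<Rightarrow> ('d \<Rightarrow> 'd) \<Rightarrow> ('d \<Rightarrow> bool) \<Rightarrow> 'd \<Rightarrow> 'd" where
  "end_c alpha sigma tw h = (if tw h then sigma (alpha h) else sigma (sigma (alpha h)))"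
definition end_d :: "('d \<Rightarrow> 'd) \<Rightarrow> ('d \<Rightarrow> 'd) \<Rightarrow> ('d \<Rightarrow> bool) \<Rightarrow> 'd \<Rightarrow> 'd" where
  "end_d alpha sigma tw h = (if tw h then sigma (sigma (alpha h)) else sigma (alpha h))"

text \<open>A state alpha in {0,1}^l is represented by the set s \<subseteq> {..<l} of indices i with
alpha_i = 1. The curves of the state are built from the non-matching edges (pairs of
non-matching darts) together with the arcs created by the smoothings; a curve is
represented by its set of non-matching darts.\<close>

definition state_link ::
  "'d set \<Rightarrow> ('d \<Rightarrow> 'd) \<Rightarrow> ('d \<Rightarrow> 'd) \<Rightarrow> ('d \<Rightarrow> bool) \<Rightarrow> 'd list \<Rightarrow> nat set \<Rightarrow> ('d \<times> 'd) set" where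
  "state_link D alpha sigma tw es s =
     {(x, y). x \<in> D - matching_darts alpha es \<and> y \<in> D - matching_darts alpha es \<and>
       (y = alpha x \<or>
        (\<exists>i<length es.
           (i \<notin> s \<and> ({x, y} = {end_a sigma (es!i), end_c alpha sigma tw (es!i)} \<or>
                      {x, y} = {end_b sigma (es!i), end_d alpha sigma tw (es!i)})) \<or>
           (i \<in> s \<and> ({x, y} = {end_a sigma (es!i), end_d alpha sigma tw (es!i)} \<or>
                      {x, y} = {end_b sigma (es!i), end_c alpha sigma tw (es!i)}))))}"

definition curve_of ::
  "'d set \<Rightarrow> ('d \<Rightarrow> 'd) \<Rightarrow> ('d \<Rightarrow> 'd) \<Rightarrow> ('d \<Rightarrow> bool) \<Rightarrow> 'd list \<Rightarrow> nat set \<Rightarrow> 'd \<Rightarrow> 'd set" where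
  "curve_of D alpha sigma tw es s x =
     {y \<in> D - matching_darts alpha es. (x, y) \<in> (state_link D alpha sigma tw es s)\<^sup>*}"

definition curves ::
  "'d set \<Rightarrow> ('d \<Rightarrow> 'd) \<Rightarrow> ('d \<Rightarrow> 'd) \<Rightarrow> ('d \<Rightarrow> bool) \<Rightarrow> 'd list \<Rightarrow> nat set \<Rightarrow> 'd set set" where
  "curves D alpha sigma tw es s = curve_of D alpha sigma tw es s ` (D - matching_darts alpha es)"

text \<open>N(Gamma_alpha): colorings of the curves with colors 1..n such that for each matching
edge the two arcs produced by its smoothing (through a and through b respectively) lie on
curves of different colors.\<close>

definition N_state ::
  "'d set \<Rightarrow> ('d \<Rightarrow> 'd) \<Rightarrow> ('d \<Rightarrow> 'd) \<Rightarrow> ('d \<Rightarrow> bool) \<Rightarrow> 'd list \<Rightarrow> nat \<Rightarrow> nat set \<Rightarrow> nat" where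
  "N_state D alpha sigma tw es n s =
     card {col \<in> curves D alpha sigma tw es s \<rightarrow>\<^sub>E {1..n}.
             \<forall>i<length es. col (curve_of D alpha sigma tw es s (end_a sigma (es!i)))
                          \<noteq> col (curve_of D alpha sigma tw es s (end_b sigma (es!i)))}"

definition color_bracket ::
  "'d set \<Rightarrow> ('d \<Rightarrow> 'd) \<Rightarrow> ('d \<Rightarrow> 'd) \<Rightarrow> ('d \<Rightarrow> bool) \<Rightarrow> 'd list \<Rightarrow> nat \<Rightarrow> nat" where
  "color_bracket D alpha sigma tw es n =
     (\<Sum>s\<in>Pow {..<length es}. N_state D alpha sigma tw es n s)"

text \<open>The basis of hat V = C[x]/(x^n-1) is x^0,...,x^(n-1); a basis element of hat V^(tensor k_alpha)
is an assignment of exponents in {..<n} to the curves of the state. A basis element of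
the whole complex is a pair (s, f) of a state and such an assignment; it lies in degree |s|.\<close>

definition half_n :: "nat \<Rightarrow> nat" where
  "half_n n = (if even n then n div 2 else (n - 1) div 2)"

definition cx_basis ::
  "'d set \<Rightarrow> ('d \<Rightarrow> 'd) \<Rightarrow> ('d \<Rightarrow> 'd) \<Rightarrow> ('d \<Rightarrow> bool) \<Rightarrow> 'd list \<Rightarrow> nat \<Rightarrow> nat
     \<Rightarrow> (nat set \<times> ('d set \<Rightarrow> nat)) set" where
  "cx_basis D alpha sigma tw es n i =
     {(s, f). s \<subseteq> {..<length es} \<and> card s = i \<and> f \<in> curves D alpha sigma tw es s \<rightarrow>\<^sub>E {..<n}}"

text \<open>Matrix coefficient of the differential from basis element (s,f) to basis element (s',g).
The hypercube edge changes coordinate i from 0 to 1, with Khovanov sign (-1)^(number of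
1-coordinates before i). The involved curves are those through a and b of edge e_i.\<close>

definition cx_coeff ::
  "'d set \<Rightarrow> ('d \<Rightarrow> 'd) \<Rightarrow> ('d \<Rightarrow> 'd) \<Rightarrow> ('d \<Rightarrow> bool) \<Rightarrow> 'd list \<Rightarrow> nat
     \<Rightarrow> (nat set \<times> ('d set \<Rightarrow> nat)) \<Rightarrow> (nat set \<times> ('d set \<Rightarrow> nat)) \<Rightarrow> complex" where
  "cx_coeff D alpha sigma tw es n tgt src =
     (let (s', g) = tgt; (s, f) = src; m = half_n n;
          cv = curve_of D alpha sigma tw es s; cv' = curve_of D alpha sigma tw es s' in
      if \<exists>i<length es. i \<notin> s \<and> s' = insert i s then
        (let i = (THE i. i < length es \<and> i \<notin> s \<and> s' = insert i s);
             a = end_a sigma (es!i); b = end_b sigma (es!i);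
             sgn = (-1::complex) ^ card {j\<in>s. j < i} in
         if (\<forall>x\<in>curves D alpha sigma tw es s'. x \<noteq> cv' a \<and> x \<noteq> cv' b \<longrightarrow> g x = f x) then
           (if cv a \<noteq> cv b \<and> cv' a = cv' b then
              (if g (cv' a) = (f (cv a) + f (cv b)) mod n then sgn else 0)
            else if cv a = cv b \<and> cv' a \<noteq> cv' b then
              (if (g (cv' a) + g (cv' b)) mod n = (f (cv a) + 2 * m) mod n then sgn else 0)
            else if cv a = cv b \<and> cv' a = cv' b then
              (if g (cv' a) = (f (cv a) + m) mod n then sgn * complex_of_real (sqrt (real n)) else 0)
            else 0)
         else 0)
      else 0)"

definition chains ::
  "'d set \<Rightarrow> ('d \<Rightarrow> 'd) \<Rightarrow> ('d \<Rightarrow> 'd) \<Rightarrow> ('d \<Rightarrow> bool) \<Rightarrow> 'd list \<Rightarrow> nat \<Rightarrow> nat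
     \<Rightarrow> ((nat set \<times> ('d set \<Rightarrow> nat)) \<Rightarrow> complex) set" where
  "chains D alpha sigma tw es n i =
     {v. \<forall>x. x \<notin> cx_basis D alpha sigma tw es n i \<longrightarrow> v x = 0}"

definition cx_diff ::
  "'d set \<Rightarrow> ('d \<Rightarrow> 'd) \<Rightarrow> ('d \<Rightarrow> 'd) \<Rightarrow> ('d \<Rightarrow> bool) \<Rightarrow> 'd list \<Rightarrow> nat \<Rightarrow> nat
     \<Rightarrow> ((nat set \<times> ('d set \<Rightarrow> nat)) \<Rightarrow> complex) \<Rightarrow> ((nat set \<times> ('d set \<Rightarrow> nat)) \<Rightarrow> complex)" where
  "cx_diff D alpha sigma tw es n i v =
     (\<lambda>y. if y \<in> cx_basis D alpha sigma tw es n (Suc i)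
          then (\<Sum>x\<in>cx_basis D alpha sigma tw es n i. cx_coeff D alpha sigma tw es n y x * v x)
          else 0)"

definition cscale :: "complex \<Rightarrow> ('b \<Rightarrow> complex) \<Rightarrow> ('b \<Rightarrow> complex)" where
  "cscale c v = (\<lambda>x. c * v x)"

definition homology_dim ::
  "'d set \<Rightarrow> ('d \<Rightarrow> 'd) \<Rightarrow> ('d \<Rightarrow> 'd) \<Rightarrow> ('d \<Rightarrow> bool) \<Rightarrow> 'd list \<Rightarrow> nat \<Rightarrow> nat \<Rightarrow> nat" where
  "homology_dim D alpha sigma tw es n i =
     vector_space.dim cscale
        {v \<in> chains D alpha sigma tw es n i. cx_diff D alpha sigma tw es n i v = 0}
     - (if i = 0 then 0 else
        vector_space.dim cscale
          (cx_diff D alpha sigma tw es n (i - 1) ` chains D alpha sigma tw es n (i - 1)))"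

definition total_face_color ::
  "'d set \<Rightarrow> ('d \<Rightarrow> 'd) \<Rightarrow> ('d \<Rightarrow> 'd) \<Rightarrow> ('d \<Rightarrow> bool) \<Rightarrow> 'd list \<Rightarrow> nat \<Rightarrow> nat" where
  "total_face_color D alpha sigma tw es n =
     (\<Sum>i\<le>length es. homology_dim D alpha sigma tw es n i)"

end

theory Submission
  imports Defs
begin

text \<open>
  Over the complex numbers the algebra \<open>\<complex>[x]/(x\<^sup>n - 1)\<close> has a basis of (multiples of) idempotents, indexed
  by the \<open>n\<close>-th roots of unity. Hence the chain space of a state has a basis indexed by the colorings of
  its curves with \<open>n\<close> colors, i.e. by the colorings of the non-matching darts that are constant on
  curves. In these bases an edge of the hypercube sends a coloring to a nonzero multiple of the same
  dart coloring if that coloring is compatible with both states, and to zero otherwise; it is compatible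
  with both exactly if the two arcs at the smoothed edge have the same color. So the complex splits into
  one summand per dart coloring. If some matching edge has two arcs of the same color, switching the
  smoothing there (at the first such edge, the pivot) pairs off all states of the summand, which is therefore
  acyclic. Otherwise only one state is compatible with the coloring, the summand is one-dimensional
  with zero differential, and the coloring is counted once by the color bracket.
\<close>

subsection \<open>Linear algebra\<close>

context vector_space
begin

lemma spanning_family_inj_independent:
  assumes "finite B" "independent T" "T \<subseteq> span (w ` B)" "card B = card T"
  shows "inj_on w B \<and> independent (w ` B)"
proof -
  obtain S where S: "S \<subseteq> w ` B" "independent S" "w ` B \<subseteq> span S"
    using maximal_independent_subset[of "w ` B"] by blast
  have fS: "finite S" using S(1) assms(1) finite_subset by blast
  have "T \<subseteq> span S"
    using assms(3) span_minimal[OF S(3) subspace_span] by blast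
  then have "card T \<le> card S"
    using independent_span_bound[OF fS assms(2)] by blast
  moreover have "card S \<le> card (w ` B)" using S(1) assms(1) card_mono by blast
  moreover have "card (w ` B) \<le> card B" using assms(1) card_image_le by blast
  ultimately have "card S = card (w ` B)" "card (w ` B) = card B" using assms(4) by auto
  then show ?thesis
    using S assms(1) card_subset_eq[OF finite_imageI S(1)] eq_card_imp_inj_on[OF assms(1)] by simp
qed

lemma dim_span_image:
  assumes "inj_on w B" "independent (w ` B)"
  shows "dim (span (w ` B)) = card B"
  using dim_span_eq_card_independent[OF assms(2)] card_image[OF assms(1)] by (rule trans)

lemma independent_familyD:
  assumes "finite B" "inj_on w B" "independent (w ` B)" "(\<Sum>x\<in>B. r x *s w x) = 0" "x \<in> B"
  shows "r x = 0"
proof -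
  have "(\<Sum>v\<in>w ` B. r (the_inv_into B w v) *s v) = (\<Sum>x\<in>B. r x *s w x)"
    using assms(2) by (simp add: sum.reindex the_inv_into_f_f)
  then have "r (the_inv_into B w (w x)) = 0"
    using independentD[OF assms(3) finite_imageI[OF assms(1)] subset_refl,
        of "\<lambda>v. r (the_inv_into B w v)" "w x"] assms(4,5) by simp
  then show ?thesis using assms by (simp add: the_inv_into_f_f)
qed

lemma in_span_family:
  assumes "finite B" "v \<in> span (w ` B)"
  obtains r where "v = (\<Sum>x\<in>B. r x *s w x)"
proof -
  have "\<exists>r. v = (\<Sum>x\<in>B. r x *s w x)"
    using assms(2)
  proof (induction rule: span_induct_alt)
    case base
    show ?case by (rule exI[of _ "\<lambda>_. 0"]) simp
  next
    case (step c y z)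
    then obtain r x where r: "z = (\<Sum>x\<in>B. r x *s w x)" and x: "x \<in> B" "y = w x" by blast
    have "c *s y + z = (\<Sum>u\<in>B. (if u = x then c + r u else r u) *s w u)"
    proof -
      have "(\<Sum>u\<in>B. (if u = x then c + r u else r u) *s w u)
        = (\<Sum>u\<in>B. (if u = x then c *s w u else 0) + r u *s w u)"
        by (intro sum.cong) (auto simp: scale_left_distrib)
      then show ?thesis using x r assms(1) by (simp add: sum.distrib)
    qed
    then show ?case by (rule exI[of _ "\<lambda>u. if u = x then c + r u else r u"])
  qed
  then show ?thesis using that by blast
qed

text \<open>Applying \<open>d\<close> to an expansion kills the \<open>Z\<close> terms and leaves a
  combination of the independent family \<open>d \<circ> w\<close> on \<open>U\<close>. Hence a
  kernel element has zero coefficients on \<open>U\<close>, and the kernel is spanned by the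
  \<open>Z\<close> vectors.\<close>

lemma dim_kernel_of_family:
  assumes fin: "finite Z" "finite U" and ZU: "Z \<inter> U = {}"
    and w: "inj_on w (Z \<union> U)" "independent (w ` (Z \<union> U))"
    and add: "\<And>x y. d (x + y) = d x + d y" and scale: "\<And>c x. d (c *s x) = c *s d x"
    and dZ: "\<And>x. x \<in> Z \<Longrightarrow> d (w x) = 0"
    and dU: "inj_on (d \<circ> w) U" "independent ((d \<circ> w) ` U)"
  shows "dim {v \<in> span (w ` (Z \<union> U)). d v = 0} = card Z"
proof -
  have d0: "d 0 = 0" using add[of 0 0] by simp
  have dsum: "d (\<Sum>x\<in>A. r x *s w x) = (\<Sum>x\<in>A. r x *s d (w x))" if "finite A" for A r
    using that by (induction A rule: finite_induct) (auto simp: add scale d0)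
  have "{v \<in> span (w ` (Z \<union> U)). d v = 0} = span (w ` Z)"
  proof (intro equalityI subsetI; clarsimp)
    fix v assume v: "v \<in> span (w ` (Z \<union> U))" "d v = 0"
    obtain r where r: "v = (\<Sum>x\<in>Z \<union> U. r x *s w x)"
      using in_span_family[OF _ v(1)] fin by blast
    have "d v = (\<Sum>x\<in>Z \<union> U. r x *s d (w x))" using r dsum fin by simp
    also have "\<dots> = (\<Sum>x\<in>Z. r x *s d (w x)) + (\<Sum>x\<in>U. r x *s d (w x))"
      by (rule sum.union_disjoint[OF fin ZU])
    also have "\<dots> = (\<Sum>x\<in>U. r x *s (d \<circ> w) x)" using dZ by simp
    finally have "(\<Sum>x\<in>U. r x *s (d \<circ> w) x) = 0" using v by simp
    then have "r x = 0" if "x \<in> U" for x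
      using independent_familyD[OF fin(2) dU] that by blast
    then have "v = (\<Sum>x\<in>Z. r x *s w x)"
      unfolding r by (subst sum.union_disjoint[OF fin ZU]) simp
    then show "v \<in> span (w ` Z)"
      by (simp add: span_sum span_scale span_base)
  next
    fix v assume v: "v \<in> span (w ` Z)"
    obtain r where r: "v = (\<Sum>x\<in>Z. r x *s w x)"
      using in_span_family[OF _ v] fin by blast
    have "d v = 0" using dsum[OF fin(1)] dZ r by simp
    then show "v \<in> span (w ` (Z \<union> U)) \<and> d v = 0"
      using v span_mono[of "w ` Z" "w ` (Z \<union> U)"] by blast
  qed
  moreover have "independent (w ` Z)" using w(2) by (rule independent_mono) blast
  moreover have "inj_on w Z" using w(1) by (rule inj_on_subset) blast
  ultimately show ?thesis using dim_span_image[of w Z] by metis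
qed

text \<open>The \<open>Z\<close> vectors contribute only zero to the image, so the independent
  images of the \<open>U\<close> vectors already span it.\<close>

lemma dim_image_of_family:
  assumes fin: "finite Z" "finite U"
    and add: "\<And>x y. d (x + y) = d x + d y" and scale: "\<And>c x. d (c *s x) = c *s d x"
    and dZ: "\<And>x. x \<in> Z \<Longrightarrow> d (w x) = 0"
    and dU: "inj_on (d \<circ> w) U" "independent ((d \<circ> w) ` U)"
  shows "dim (d ` span (w ` (Z \<union> U))) = card U"
proof -
  interpret h: module_hom scale scale d
    by (unfold_locales) (auto simp: add scale algebra_simps)
  have "d ` span (w ` (Z \<union> U)) = span ((d \<circ> w) ` Z \<union> (d \<circ> w) ` U)"
    by (simp add: h.span_image[symmetric] image_Un image_comp)
  also have "\<dots> = span ((d \<circ> w) ` U)"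
  proof (rule antisym)
    have "(d \<circ> w) ` Z \<union> (d \<circ> w) ` U \<subseteq> span ((d \<circ> w) ` U)"
      proof (intro Un_least image_subsetI)
      fix x assume "x \<in> Z"
      then show "(d \<circ> w) x \<in> span ((d \<circ> w) ` U)" using dZ by (simp add: span_zero)
    qed (simp add: span_base)
    then show "span ((d \<circ> w) ` Z \<union> (d \<circ> w) ` U) \<subseteq> span ((d \<circ> w) ` U)"
      by (rule span_minimal) (rule subspace_span)
  qed (rule span_mono, blast)
  finally show ?thesis using dim_span_image[OF dU] by simp
qed

end

section \<open>Finitely supported complex functions and their coordinate vectors\<close>

interpretation cvs: vector_space "cscale :: complex \<Rightarrow> ('b \<Rightarrow> complex) \<Rightarrow> 'b \<Rightarrow> complex"
  by unfold_locales (auto simp: cscale_def algebra_simps fun_eq_iff)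

definition delta :: "'b \<Rightarrow> 'b \<Rightarrow> complex" where
  "delta x = (\<lambda>y. if y = x then 1 else 0)"

lemma inj_delta: "inj_on delta S"
  by (rule inj_onI) (metis delta_def zero_neq_one)

lemma delta_expansion:
  assumes "finite S"
  shows "(\<Sum>x\<in>S. cscale (r x) (delta x)) = (\<lambda>y. if y \<in> S then r y else 0)"
  using assms
  by (induction S rule: finite_induct) (auto simp: cscale_def delta_def fun_eq_iff)

lemma independent_delta:
  assumes "finite S"
  shows "cvs.independent (delta ` S)"
proof (rule cvs.independent_if_scalars_zero)
  fix r :: "('a \<Rightarrow> complex) \<Rightarrow> complex" and v
  assume eq: "(\<Sum>v\<in>delta ` S. cscale (r v) v) = 0" and v: "v \<in> delta ` S"
  have "(\<Sum>x\<in>S. cscale (r (delta x)) (delta x)) = 0"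
    using eq inj_delta by (subst (asm) sum.reindex) (auto simp: o_def)
  then show "r v = 0"
    using v unfolding delta_expansion[OF assms] by (auto simp: fun_eq_iff split: if_splits)
qed (use assms in simp)

lemma span_delta:
  assumes "finite S"
  shows "cvs.span (delta ` S) = {v. \<forall>x. x \<notin> S \<longrightarrow> v x = 0}"
proof (intro equalityI subsetI)
  fix v assume "v \<in> cvs.span (delta ` S)"
  then obtain r where "v = (\<Sum>x\<in>S. cscale (r x) (delta x))"
    using cvs.in_span_family[OF assms] by blast
  then show "v \<in> {v. \<forall>x. x \<notin> S \<longrightarrow> v x = 0}" by (simp add: delta_expansion[OF assms])
next
  fix v :: "'a \<Rightarrow> complex" assume "v \<in> {v. \<forall>x. x \<notin> S \<longrightarrow> v x = 0}"
  then have "v = (\<Sum>x\<in>S. cscale (v x) (delta x))"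
    by (auto simp: delta_expansion[OF assms] fun_eq_iff)
  then show "v \<in> cvs.span (delta ` S)"
    by (metis (mono_tags, lifting) cvs.span_base cvs.span_scale cvs.span_sum imageI)
qed

subsection \<open>Roots of unity\<close>

text \<open>The dual orthogonality needed to invert the Fourier transform is supplied by the symmetry
  \<open>\<zeta>\<^sub>p^q = \<zeta>\<^sub>q^p\<close>.\<close>

definition zeta :: "nat \<Rightarrow> nat \<Rightarrow> complex" where
  "zeta n p = cis (2 * pi * real p / real n)"

lemma zeta_nonzero [simp]: "zeta n p \<noteq> 0"
  by (simp add: zeta_def)

lemma zeta_power_n: "0 < n \<Longrightarrow> zeta n p ^ n = 1"
  using cis_multiple_2pi[of "real p"] by (simp add: zeta_def DeMoivre)

lemma zeta_swap: "zeta n p ^ q = zeta n q ^ p"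
  by (simp add: zeta_def DeMoivre mult_ac)

lemma zeta_inj: "0 < n \<Longrightarrow> inj_on (zeta n) {..<n}"
  using bij_betw_roots_unity[of n] by (simp add: zeta_def[abs_def] bij_betw_def)

lemma zeta_power_mod:
  assumes "0 < n"
  shows "zeta n p ^ (k mod n) = zeta n p ^ k"
proof -
  have "zeta n p ^ k = zeta n p ^ (n * (k div n) + k mod n)" by simp
  also have "\<dots> = zeta n p ^ (k mod n)"
    by (simp only: power_add power_mult zeta_power_n[OF assms] power_one mult_1)
  finally show ?thesis by simp
qed

lemma zeta_power_cong: "0 < n \<Longrightarrow> k mod n = k' mod n \<Longrightarrow> zeta n p ^ k = zeta n p ^ k'"
  by (metis zeta_power_mod)

text \<open>For different indices the ratio is an \<open>n\<close>-th root of unity other than 1, so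
  the geometric sum vanishes.\<close>

lemma zeta_orthogonality:
  assumes "0 < n" "p < n" "q < n"
  shows "(\<Sum>k<n. (zeta n p / zeta n q) ^ k) = (if p = q then of_nat n else 0)"
proof (cases "p = q")
  case False
  then have "zeta n p / zeta n q \<noteq> 1"
    using inj_onD[OF zeta_inj[OF assms(1)], of p q] assms by auto
  then show ?thesis
    using False assms geometric_sum[of "zeta n p / zeta n q" n]
    by (simp only: if_False) (simp add: power_divide zeta_power_n)
qed simp

text \<open>Adding \<open>r\<close> permutes the residues, so exactly one \<open>k\<close> satisfies
  the congruence, and powers of \<open>zeta n p\<close> only see residues. The quotient expresses
  the exponent \<open>g - r\<close> without subtracting naturals. Merge, split and single-cycle maps
  all reduce to such a sum.\<close>

lemma sum_zeta_shift:
  assumes "0 < n"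
  shows "(\<Sum>k<n. if g mod n = (k + r) mod n then zeta n p ^ k else 0) = zeta n p ^ g / zeta n p ^ r"
proof -
  have inj: "inj_on (\<lambda>k. (k + r) mod n) {..<n}"
  proof (rule linorder_inj_onI')
    fix i j assume ij: "i \<in> {..<n}" "j \<in> {..<n}" "i < j"
    show "(i + r) mod n \<noteq> (j + r) mod n"
    proof
      assume "(i + r) mod n = (j + r) mod n"
      then have "n dvd (j + r) - (i + r)" using ij mod_eq_dvd_iff_nat[of "i + r" "j + r" n] by simp
      then show False using ij by (auto dest: dvd_imp_le)
    qed
  qed
  then have "(\<lambda>k. (k + r) mod n) ` {..<n} = {..<n}"
    using assms by (intro endo_inj_surj) auto
  moreover have "g mod n \<in> {..<n}" using assms by simp
  ultimately obtain k where k: "k < n" "(k + r) mod n = g mod n"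
    by (metis (no_types, lifting) imageE lessThan_iff)
  have uniq: "g mod n = (j + r) mod n \<longleftrightarrow> j = k" if "j < n" for j
    using k that inj_onD[OF inj, of j k] by auto
  have "(\<Sum>j<n. if g mod n = (j + r) mod n then zeta n p ^ j else 0)
      = (\<Sum>j<n. if j = k then zeta n p ^ j else 0)"
    by (intro sum.cong) (simp_all add: uniq)
  also have "\<dots> = zeta n p ^ k" using k by simp
  also have "\<dots> = zeta n p ^ g / zeta n p ^ r"
    using zeta_power_cong[OF assms k(2), of p] by (simp add: power_add field_simps)
  finally show ?thesis .
qed

subsection \<open>The curves of a state\<close>

text \<open>Induction removing one two-element orbit \<open>{x, f x}\<close> at a time.\<close>

lemma even_card_involution:
  assumes "finite A" "\<And>x. x \<in> A \<Longrightarrow> f x \<in> A" "\<And>x. x \<in> A \<Longrightarrow> f x \<noteq> x" "\<And>x. x \<in> A \<Longrightarrow> f (f x) = x"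
  shows "even (card A)"
  using assms
proof (induction A rule: finite_psubset_induct)
  case (psubset A)
  show ?case
  proof (cases "A = {}")
    case False
    then obtain x where x: "x \<in> A" by blast
    let ?B = "A - {x, f x}"
    have fx: "f x \<in> A" "f x \<noteq> x" "f (f x) = x" using psubset.prems x by auto
    have inj: "f y \<notin> {x, f x}" if "y \<in> ?B" for y
    proof
      assume "f y \<in> {x, f x}"
      then have "f (f y) \<in> {f x, x}" using fx by auto
      then show False using that psubset.prems(3) by auto
    qed
    have "even (card ?B)"
      by (rule psubset.IH) (use x inj psubset.prems in auto)
    moreover have "card A = card ?B + 2"
      using card_Diff_subset[of "{x, f x}" A] card_mono[of A "{x, f x}"] psubset.hyps x fx
      by (auto simp del: card_Diff_insert)
    ultimately show ?thesis by simp
  qed simp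
qed

lemma even_card_Int_pairs:
  assumes "p \<in> W \<longleftrightarrow> q \<in> W" "u \<in> W \<longleftrightarrow> v \<in> W" "distinct [p, q, u, v]"
  shows "even (card (W \<inter> {p, q, u, v}))"
  using assms by (cases "p \<in> W"; cases "u \<in> W") (simp_all add: Int_insert_right)

section \<open>Darts around the matching edges\<close>

locale matched_ribbon_graph =
  fixes D :: "'d set" and alpha sigma :: "'d \<Rightarrow> 'd" and vert :: "'d \<Rightarrow> 'v"
    and tw :: "'d \<Rightarrow> bool" and es :: "'d list"
  assumes pmg: "perfect_matching_graph D alpha vert sigma tw es"
begin

abbreviation "M \<equiv> matching_darts alpha es"
abbreviation "X \<equiv> D - M"
abbreviation "a i \<equiv> end_a sigma (es ! i)"
abbreviation "b i \<equiv> end_b sigma (es ! i)"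
abbreviation "c i \<equiv> end_c alpha sigma tw (es ! i)"
abbreviation "d i \<equiv> end_d alpha sigma tw (es ! i)"
abbreviation "link s \<equiv> state_link D alpha sigma tw es s"
abbreviation "cv s x \<equiv> curve_of D alpha sigma tw es s x"
abbreviation "Cv s \<equiv> curves D alpha sigma tw es s"

lemma finite_D: "finite D"
  and alpha: "h \<in> D \<Longrightarrow> alpha h \<in> D" "h \<in> D \<Longrightarrow> alpha h \<noteq> h" "h \<in> D \<Longrightarrow> alpha (alpha h) = h"
  and trivalent: "h \<in> D \<Longrightarrow> card {h'\<in>D. vert h' = vert h} = 3"
  and sigma: "h \<in> D \<Longrightarrow> sigma h \<in> D" "h \<in> D \<Longrightarrow> vert (sigma h) = vert h"
    "h \<in> D \<Longrightarrow> sigma h \<noteq> h" "h \<in> D \<Longrightarrow> sigma (sigma (sigma h)) = h"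
  and distinct_es: "distinct es" and es_D: "set es \<subseteq> D"
  and alpha_es: "i < length es \<Longrightarrow> j < length es \<Longrightarrow> alpha (es ! i) \<noteq> es ! j"
  and matched: "h \<in> D \<Longrightarrow> card {h'\<in>M. vert h' = vert h} = 1"
  using pmg unfolding perfect_matching_graph_def by blast+

lemma sigma_sigma_neq: "h \<in> D \<Longrightarrow> sigma (sigma h) \<noteq> h"
  using sigma by metis

lemma M_D: "M \<subseteq> D"
  using es_D alpha by (auto simp: matching_darts_def)

lemma M_unique: "h \<in> M \<Longrightarrow> h' \<in> M \<Longrightarrow> vert h = vert h' \<Longrightarrow> h = h'"
  using matched[of h] M_D by (auto simp: card_1_singleton_iff set_eq_iff subset_iff) metis

lemma alpha_M: "h \<in> M \<Longrightarrow> alpha h \<in> M"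
  using es_D alpha by (auto simp: matching_darts_def)

lemma alpha_X: "x \<in> X \<Longrightarrow> alpha x \<in> X"
  using alpha alpha_M by (metis DiffE DiffI)

lemma es_M: "i < length es \<Longrightarrow> es ! i \<in> M" "i < length es \<Longrightarrow> alpha (es ! i) \<in> M"
  by (auto simp: matching_darts_def)

lemma sigma_X: "h \<in> M \<Longrightarrow> sigma h \<in> X" "h \<in> M \<Longrightarrow> sigma (sigma h) \<in> X"
  using M_D M_unique[of h "sigma h"] M_unique[of h "sigma (sigma h)"] sigma sigma_sigma_neq
  by (metis DiffI subsetD)+

lemma ends_X:
  assumes "i < length es"
  shows "a i \<in> X" "b i \<in> X" "c i \<in> X" "d i \<in> X"
  unfolding end_a_def end_b_def end_c_def end_d_def
  using sigma_X es_M[OF assms] by (auto simp del: Diff_iff)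

lemma vert_ends:
  assumes "i < length es"
  shows "vert (a i) = vert (es ! i)" "vert (b i) = vert (es ! i)"
    "vert (c i) = vert (alpha (es ! i))" "vert (d i) = vert (alpha (es ! i))"
  unfolding end_a_def end_b_def end_c_def end_d_def
  using es_M[OF assms] M_D sigma by auto

lemma ends_distinct:
  assumes "i < length es"
  shows "distinct [a i, b i, c i, d i]"
proof -
  have D: "es ! i \<in> D" "alpha (es ! i) \<in> D" using es_M[OF assms] M_D by auto
  have "vert (es ! i) \<noteq> vert (alpha (es ! i))"
    using M_unique es_M[OF assms] alpha D by metis
  moreover have "a i \<noteq> b i" "c i \<noteq> d i"
    using D sigma unfolding end_a_def end_b_def end_c_def end_d_def by metis+
  ultimately show ?thesis using vert_ends[OF assms] by auto
qed

definition ends :: "nat \<Rightarrow> 'd set" where "ends i = {a i, b i, c i, d i}"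

text \<open>A common dart would give the two matching edges a common vertex, and since a vertex
  carries only one matching dart, the edges would coincide; but each is listed once.\<close>

lemma ends_disjoint:
  assumes "i < length es" "j < length es" "i \<noteq> j"
  shows "ends i \<inter> ends j = {}"
proof (rule ccontr)
  assume "ends i \<inter> ends j \<noteq> {}"
  then obtain x where x: "x \<in> ends i" "x \<in> ends j" by blast
  have "vert x \<in> {vert (es ! i), vert (alpha (es ! i))}"
    using x(1) vert_ends[OF assms(1)] by (auto simp: ends_def)
  moreover have "vert x \<in> {vert (es ! j), vert (alpha (es ! j))}"
    using x(2) vert_ends[OF assms(2)] by (auto simp: ends_def)
  ultimately have "{es ! i, alpha (es ! i)} \<inter> {es ! j, alpha (es ! j)} \<noteq> {}"
    using M_unique es_M[OF assms(1)] es_M[OF assms(2)] by auto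
  moreover have "es ! i \<noteq> es ! j" using assms distinct_es nth_eq_iff_index_eq by blast
  moreover from this have "alpha (es ! i) \<noteq> alpha (es ! j)"
    using alpha es_M assms M_D by (metis subsetD)
  ultimately show False using alpha_es[OF assms(1,2)] alpha_es[OF assms(2,1)] by auto
qed

text \<open>The vertex of a non-matching dart carries a matching dart \<open>h\<close>. By
  trivalence \<open>h\<close>, \<open>sigma h\<close> and \<open>sigma (sigma h)\<close> are all the
  darts there, so the given one is among the last two.\<close>

lemma ends_cover: "X = (\<Union>i<length es. ends i)"
proof (intro equalityI subsetI)
  fix x assume x: "x \<in> X"
  then obtain h where h: "h \<in> M" "vert h = vert x"
    using matched[of x] by (auto simp: card_1_singleton_iff set_eq_iff)
  have hD: "h \<in> D" using h M_D by blast
  have "card {h, sigma h, sigma (sigma h)} = 3"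
    using hD sigma sigma_sigma_neq by (metis card_3_iff)
  moreover have "{h, sigma h, sigma (sigma h)} \<subseteq> {h'\<in>D. vert h' = vert h}"
    using hD sigma by auto
  ultimately have "{h, sigma h, sigma (sigma h)} = {h'\<in>D. vert h' = vert h}"
    using trivalent[OF hD] finite_D by (intro card_subset_eq) auto
  then have "x \<in> {h, sigma h, sigma (sigma h)}" using x h(2) by simp
  then have x': "x \<in> {sigma h, sigma (sigma h)}" using x h(1) by blast
  obtain i where i: "i < length es" "h = es ! i \<or> h = alpha (es ! i)"
    using h(1) by (auto simp: matching_darts_def in_set_conv_nth)
  then have "x \<in> ends i"
    using x' by (auto simp: ends_def end_a_def end_b_def end_c_def end_d_def)
  then show "x \<in> (\<Union>i<length es. ends i)" using i by blast
next
  fix x assume "x \<in> (\<Union>i<length es. ends i)"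
  then show "x \<in> X" using ends_X by (auto simp: ends_def simp del: Diff_iff)
qed

section \<open>Curves as connectivity classes of the link relation\<close>

lemma link_X: "(x, y) \<in> link s \<Longrightarrow> x \<in> X \<and> y \<in> X"
  by (simp add: state_link_def)

lemma link_sym: "(x, y) \<in> link s \<Longrightarrow> (y, x) \<in> link s"
  using alpha by (auto simp: state_link_def insert_commute)

lemma sym_link_rtrancl: "sym ((link s)\<^sup>*)"
  using link_sym by (intro sym_rtrancl symI)

lemma cv_self: "x \<in> X \<Longrightarrow> x \<in> cv s x"
  by (simp add: curve_of_def)

lemma cv_subset: "cv s x \<subseteq> X"
  by (auto simp: curve_of_def)

lemma cv_closed: "y \<in> cv s x \<Longrightarrow> (y, z) \<in> link s \<Longrightarrow> z \<in> cv s x"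
  unfolding curve_of_def using link_X by (auto intro: rtrancl_into_rtrancl)

lemma cv_cong:
  assumes "x \<in> X" "y \<in> cv s x"
  shows "cv s y = cv s x"
proof -
  have "(x, y) \<in> (link s)\<^sup>*" "(y, x) \<in> (link s)\<^sup>*"
    using assms sym_link_rtrancl by (auto simp: curve_of_def dest: symD)
  then show ?thesis by (auto simp: curve_of_def intro: rtrancl_trans)
qed

lemma cv_eq_iff: "x \<in> X \<Longrightarrow> y \<in> X \<Longrightarrow> cv s x = cv s y \<longleftrightarrow> y \<in> cv s x"
  using cv_cong cv_self by metis

lemma cv_least:
  assumes "x \<in> Z" "\<And>y z. y \<in> Z \<Longrightarrow> (y, z) \<in> link s \<Longrightarrow> z \<in> Z"
  shows "cv s x \<subseteq> Z"
proof
  fix y assume "y \<in> cv s x"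
  then have "(x, y) \<in> (link s)\<^sup>*" by (simp add: curve_of_def)
  then show "y \<in> Z" by (induction rule: rtrancl_induct) (use assms in auto)
qed

section \<open>Arcs at one edge, and dart colorings compatible with a state\<close>

definition arc :: "nat set \<Rightarrow> nat \<Rightarrow> 'd \<Rightarrow> 'd \<Rightarrow> bool" where
  "arc s i x y \<longleftrightarrow> (if i \<in> s then {x, y} = {a i, d i} \<or> {x, y} = {b i, c i}
    else {x, y} = {a i, c i} \<or> {x, y} = {b i, d i})"

text \<open>Isolates in \<open>arc s i\<close> everything that depends on coordinate
  \<open>i\<close>, so that states differing in one coordinate can be compared.\<close>

lemma link_iff:
  "(x, y) \<in> link s \<longleftrightarrow> x \<in> X \<and> y \<in> X \<and> (y = alpha x \<or> (\<exists>i<length es. arc s i x y))"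
  unfolding state_link_def arc_def by auto

lemma arcs:
  assumes "i < length es"
  shows "i \<notin> s \<Longrightarrow> (a i, c i) \<in> link s" "i \<notin> s \<Longrightarrow> (b i, d i) \<in> link s"
    "i \<in> s \<Longrightarrow> (a i, d i) \<in> link s" "i \<in> s \<Longrightarrow> (b i, c i) \<in> link s"
  unfolding link_iff using ends_X[OF assms] assms by (auto simp: arc_def simp del: Diff_iff)

text \<open>A coloring of curves, expressed on darts: different states have different curves but the
  same non-matching darts, so one function can be tested against several states.\<close>

definition compatible :: "nat set \<Rightarrow> ('d \<Rightarrow> 'e) \<Rightarrow> bool" where
  "compatible s \<phi> \<longleftrightarrow> (\<forall>(x, y)\<in>link s. \<phi> x = \<phi> y)"

lemma compatibleD: "compatible s \<phi> \<Longrightarrow> (x, y) \<in> link s \<Longrightarrow> \<phi> x = \<phi> y"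
  unfolding compatible_def by blast

lemma compatible_iff:
  "compatible s \<phi> \<longleftrightarrow> (\<forall>x\<in>X. \<phi> (alpha x) = \<phi> x) \<and>
    (\<forall>i<length es. if i \<in> s then \<phi> (a i) = \<phi> (d i) \<and> \<phi> (b i) = \<phi> (c i)
      else \<phi> (a i) = \<phi> (c i) \<and> \<phi> (b i) = \<phi> (d i))" (is "_ \<longleftrightarrow> ?R")
proof
  assume "compatible s \<phi>"
  then have E: "\<phi> x = \<phi> y" if "(x, y) \<in> link s" for x y
    using that by (rule compatibleD)
  have "\<phi> (alpha x) = \<phi> x" if "x \<in> X" for x
    using that alpha_X[OF that] E[of x "alpha x"] by (simp add: link_iff)
  moreover have "if i \<in> s then \<phi> (a i) = \<phi> (d i) \<and> \<phi> (b i) = \<phi> (c i)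
      else \<phi> (a i) = \<phi> (c i) \<and> \<phi> (b i) = \<phi> (d i)" if "i < length es" for i
    using E arcs[OF that, of s] by simp
  ultimately show ?R by blast
next
  assume R: ?R
  have "\<phi> x = \<phi> y" if "arc s i x y" "i < length es" for i x y
  proof -
    have "if i \<in> s then \<phi> (a i) = \<phi> (d i) \<and> \<phi> (b i) = \<phi> (c i)
      else \<phi> (a i) = \<phi> (c i) \<and> \<phi> (b i) = \<phi> (d i)" using R that by blast
    then show ?thesis using that(1) unfolding arc_def by (auto simp: doubleton_eq_iff split: if_splits)
  qed
  then show "compatible s \<phi>"
    using R by (force simp: compatible_def link_iff)
qed

text \<open>The set of darts colored like \<open>x\<close> is closed under links, and the curve is
  the least such set containing \<open>x\<close>.\<close>

lemma compatible_cv: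
  assumes "compatible s \<phi>" "y \<in> cv s x"
  shows "\<phi> y = \<phi> x"
proof -
  have "cv s x \<subseteq> {y. \<phi> y = \<phi> x}"
  proof (rule cv_least)
    fix y z assume "y \<in> {y. \<phi> y = \<phi> x}" "(y, z) \<in> link s"
    then show "z \<in> {y. \<phi> y = \<phi> x}" using compatibleD[OF assms(1), of y z] by simp
  qed simp
  then show ?thesis using assms(2) by blast
qed

text \<open>The 0-smoothing identifies the colors of \<open>a\<close>, \<open>c\<close> and of
  \<open>b\<close>, \<open>d\<close>; the 1-smoothing those of \<open>a\<close>, \<open>d\<close>
  and of \<open>b\<close>, \<open>c\<close>. Both sets of identifications hold exactly when all four
  ends share one color.\<close>

lemma compatible_insert:
  assumes "compatible s \<phi>" "i < length es" "i \<notin> s"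
  shows "compatible (insert i s) \<phi> \<longleftrightarrow> \<phi> (a i) = \<phi> (b i)"
proof
  assume "compatible (insert i s) \<phi>"
  then have "\<phi> (a i) = \<phi> (d i)" using arcs(3)[OF assms(2)] compatibleD by blast
  moreover have "\<phi> (b i) = \<phi> (d i)"
    using assms(1) arcs(2)[OF assms(2,3)] by (rule compatibleD)
  ultimately show "\<phi> (a i) = \<phi> (b i)" by simp
qed (use assms in \<open>auto simp: compatible_iff\<close>)

lemma compatible_remove:
  assumes "compatible s \<phi>" "i < length es" "\<phi> (a i) = \<phi> (b i)"
  shows "compatible (s - {i}) \<phi>"
  using assms by (auto simp: compatible_iff split: if_splits)

section \<open>Effect of changing one smoothing on the curves\<close>

definition saddle :: "nat set \<Rightarrow> nat \<Rightarrow> 'd set" where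
  "saddle s i = cv s (a i) \<union> cv s (b i)"

lemma link_change:
  assumes "s - {i} = t - {i}" "(y, z) \<in> link t" "\<not> arc t i y z"
  shows "(y, z) \<in> link s"
proof -
  have "arc t j y z = arc s j y z" if "j \<noteq> i" for j
  proof -
    have "(j \<in> s) = (j \<in> t)" using that assms(1) by blast
    then show ?thesis unfolding arc_def by presburger
  qed
  then show ?thesis using assms(2,3) unfolding link_iff by metis
qed

lemma arc_ends: "arc t i y z \<Longrightarrow> y \<in> ends i \<and> z \<in> ends i"
  by (auto simp: arc_def ends_def doubleton_eq_iff split: if_splits)

text \<open>Passing from \<open>s\<close> to \<open>t\<close> introduces new links only between ends
  of edge \<open>i\<close>, which already lie in \<open>Z\<close>; hence closure under links carries
  over.\<close>

lemma link_saddle_transfer: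
  assumes "i < length es" "ends i \<subseteq> Z" "s - {i} = t - {i}"
    and cl: "\<And>y z. y \<in> Z \<Longrightarrow> (y, z) \<in> link s \<Longrightarrow> z \<in> Z"
    and yz: "y \<in> Z" "(y, z) \<in> link t"
  shows "z \<in> Z"
proof (cases "arc t i y z")
  case True
  then show ?thesis using assms(2) arc_ends by blast
next
  case False
  then show ?thesis using cl yz link_change[OF assms(3)] by blast
qed

lemma ends_saddle:
  assumes "i < length es"
  shows "ends i \<subseteq> saddle s i"
proof -
  have "a i \<in> cv s (a i)" "b i \<in> cv s (b i)" using cv_self ends_X[OF assms] by auto
  then show ?thesis
    using arcs[OF assms, of s] cv_closed unfolding ends_def saddle_def by (cases "i \<in> s") blast+
qed

lemma saddle_subset:
  assumes i: "i < length es" and st: "s - {i} = t - {i}"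
  shows "saddle t i \<subseteq> saddle s i"
proof -
  have "ends i \<subseteq> saddle s i" by (rule ends_saddle[OF i])
  moreover have cl: "z \<in> saddle s i" if "y \<in> saddle s i" "(y, z) \<in> link t" for y z
    using link_saddle_transfer[OF i ends_saddle[OF i] st _ that]
    by (auto simp: saddle_def intro: cv_closed)
  have "cv t x \<subseteq> saddle s i" if "x \<in> ends i" for x
    using cv_least[of x "saddle s i" t] cl that ends_saddle[OF i, of s] by blast
  then show ?thesis by (auto simp: saddle_def ends_def)
qed

text \<open>The change at \<open>i\<close> may merge or split the curves through \<open>a i\<close>
  and \<open>b i\<close>, but it only reconnects darts inside their union.\<close>

lemma saddle_eq: "i < length es \<Longrightarrow> s - {i} = t - {i} \<Longrightarrow> saddle t i = saddle s i"
  by (simp add: saddle_subset subset_antisym)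

text \<open>The curve of \<open>s\<close> through \<open>x\<close> misses the saddle and therefore
  every end of edge \<open>i\<close>. All \<open>t\<close>-links at its darts are then
  \<open>s\<close>-links, so it is closed for \<open>t\<close> and contains the curve of
  \<open>t\<close>.\<close>

lemma cv_outside_subset:
  assumes i: "i < length es" and st: "s - {i} = t - {i}" and x: "x \<in> X" "x \<notin> saddle s i"
  shows "cv t x \<subseteq> cv s x"
proof -
  have disj: "cv s x \<inter> saddle s i = {}"
  proof (rule ccontr)
    assume "cv s x \<inter> saddle s i \<noteq> {}"
    then obtain y where "y \<in> cv s x" "y \<in> cv s (a i) \<or> y \<in> cv s (b i)"
      by (auto simp: saddle_def)
    then have "cv s x = cv s (a i) \<or> cv s x = cv s (b i)"
      using cv_cong ends_X[OF i] x(1) by metis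
    then show False using x cv_self[OF x(1)] by (auto simp: saddle_def)
  qed
  have "z \<in> cv s x" if y: "y \<in> cv s x" and yz: "(y, z) \<in> link t" for y z
  proof -
    have "y \<notin> ends i" using ends_saddle[OF i, of s] disj y by blast
    then have "(y, z) \<in> link s" using yz link_change[OF st] arc_ends by blast
    then show ?thesis using y cv_closed by blast
  qed
  then show ?thesis using cv_least cv_self[OF x(1)] by blast
qed

lemma cv_outside:
  assumes "i < length es" "s - {i} = t - {i}" "x \<in> X" "x \<notin> saddle s i"
  shows "cv t x = cv s x"
  using cv_outside_subset[OF assms] cv_outside_subset[OF assms(1) assms(2)[symmetric] assms(3)]
    saddle_eq[OF assms(1,2)] assms(4) by blast

lemma uninvolved_subset:
  assumes i: "i < length es" and st: "s - {i} = t - {i}"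
  shows "Cv s - {cv s (a i), cv s (b i)} \<subseteq> Cv t - {cv t (a i), cv t (b i)}"
proof
  fix C assume C: "C \<in> Cv s - {cv s (a i), cv s (b i)}"
  then obtain x where x: "x \<in> X" "C = cv s x" by (auto simp: curves_def)
  have "x \<notin> saddle s i"
    using C x cv_cong[OF ends_X(1)[OF i], of x s] cv_cong[OF ends_X(2)[OF i], of x s]
    by (auto simp: saddle_def)
  then have "C = cv t x" "x \<notin> saddle t i"
    using cv_outside[OF i st] saddle_eq[OF i st] x by auto
  then show "C \<in> Cv t - {cv t (a i), cv t (b i)}"
    using x cv_self[OF x(1), of t] by (auto simp: curves_def saddle_def)
qed

text \<open>Because curves are encoded as dart sets, uninvolved curves of adjacent states are
  literally the same objects, and exponents on them can be compared directly.\<close>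

lemma uninvolved_eq:
  assumes "i < length es" "s - {i} = t - {i}"
  shows "Cv s - {cv s (a i), cv s (b i)} = Cv t - {cv t (a i), cv t (b i)}"
  using uninvolved_subset[OF assms] uninvolved_subset[OF assms(1) assms(2)[symmetric]] by blast

text \<open>If both smoothings separated the two arcs, the darts lying on the curve through \<open>a i\<close> in
  both states would be even in number (they are paired by \<open>alpha\<close>) and also odd: every other
  matching edge contributes an even number, and the edge \<open>i\<close> contributes only \<open>a i\<close>.\<close>

lemma not_both_separated:
  assumes i: "i < length es" "i \<notin> s"
  shows "cv s (a i) = cv s (b i) \<or> cv (insert i s) (a i) = cv (insert i s) (b i)"
proof (rule ccontr)
  let ?t = "insert i s"
  assume "\<not> ?thesis"
  then have sep: "b i \<notin> cv s (a i)" "b i \<notin> cv ?t (a i)"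
    using cv_eq_iff ends_X[OF i(1)] by auto
  let ?W = "cv s (a i) \<inter> cv ?t (a i)"
  have W: "?W \<subseteq> X" "finite ?W" using cv_subset finite_D by (auto intro: finite_subset)
  \<comment> \<open>Without \<open>i\<close> in the state \<open>d i\<close> is joined to
    \<open>b i\<close>; after inserting \<open>i\<close>, \<open>c i\<close> is. As
    \<open>b i\<close> lies on neither curve, \<open>a i\<close> is the only end left in the
    intersection.\<close>
  have "d i \<notin> cv s (a i)" "c i \<notin> cv ?t (a i)"
    using sep arcs[OF i(1), of s] arcs[OF i(1), of ?t] i(2) cv_closed link_sym by blast+
  then have "?W \<inter> ends i = {a i}"
    using sep cv_self[OF ends_X(1)[OF i(1)]] by (auto simp: ends_def)
  then have odd_i: "odd (card (?W \<inter> ends i))" by simp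
  have even_j: "even (card (?W \<inter> ends j))" if j: "j < length es" "j \<noteq> i" for j
  proof -
    have cl: "y \<in> ?W \<longleftrightarrow> z \<in> ?W" if "(y, z) \<in> link s" "(y, z) \<in> link ?t" for y z
      using that cv_closed link_sym by blast
    have dist: "distinct [a j, b j, c j, d j]" by (rule ends_distinct[OF j(1)])
    show ?thesis
    proof (cases "j \<in> s")
      case True
      then have "a j \<in> ?W \<longleftrightarrow> d j \<in> ?W" "b j \<in> ?W \<longleftrightarrow> c j \<in> ?W"
        using arcs(3,4)[OF j(1), of s] arcs(3,4)[OF j(1), of ?t] by (intro cl; simp)+
      moreover have "ends j = {a j, d j, b j, c j}" by (auto simp: ends_def)
      ultimately show ?thesis
        using even_card_Int_pairs[of "a j" ?W "d j" "b j" "c j"] dist by auto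
    next
      case False
      then have "a j \<in> ?W \<longleftrightarrow> c j \<in> ?W" "b j \<in> ?W \<longleftrightarrow> d j \<in> ?W"
        using arcs(1,2)[OF j(1), of s] arcs(1,2)[OF j(1), of ?t] j(2) by (intro cl; simp)+
      moreover have "ends j = {a j, c j, b j, d j}" by (auto simp: ends_def)
      ultimately show ?thesis
        using even_card_Int_pairs[of "a j" ?W "c j" "b j" "d j"] dist by auto
    qed
  qed
  have "?W = (\<Union>j<length es. ?W \<inter> ends j)" using W(1) ends_cover by blast
  then have "card ?W = card (\<Union>j<length es. ?W \<inter> ends j)" by (rule arg_cong)
  also have "\<dots> = (\<Sum>j<length es. card (?W \<inter> ends j))"
  proof (rule card_UN_disjoint)
    show "\<forall>j\<in>{..<length es}. \<forall>k\<in>{..<length es}. j \<noteq> k \<longrightarrow> (?W \<inter> ends j) \<inter> (?W \<inter> ends k) = {}"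
      using ends_disjoint by blast
  qed (use W in auto)
  also have "\<dots> = card (?W \<inter> ends i) + (\<Sum>j\<in>{..<length es} - {i}. card (?W \<inter> ends j))"
    using i by (subst sum.remove[of _ i]) auto
  finally have card_W: "card ?W = card (?W \<inter> ends i) + (\<Sum>j\<in>{..<length es} - {i}. card (?W \<inter> ends j))" .
  have "even (\<Sum>j\<in>{..<length es} - {i}. card (?W \<inter> ends j))"
    by (rule dvd_sum) (use even_j in auto)
  then have "odd (card ?W)" using odd_i card_W by simp
  moreover have "even (card ?W)"
  proof (rule even_card_involution[of ?W alpha])
    fix x assume x: "x \<in> ?W"
    then have "x \<in> X" using W by blast
    then have "(x, alpha x) \<in> link r" for r using alpha_X[of x] by (simp add: link_iff)
    then show "alpha x \<in> ?W" using x cv_closed by blast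
  qed (use W alpha in auto)
  ultimately show False by simp
qed

end

subsection \<open>The complex in the color basis\<close>

lemma sum_PiE_insert:
  assumes "x \<notin> S"
  shows "(\<Sum>f\<in>insert x S \<rightarrow>\<^sub>E B. Q f) = (\<Sum>k\<in>B. \<Sum>f\<in>S \<rightarrow>\<^sub>E B. Q (f(x := k)))"
  using inj_combinator[OF assms, of "\<lambda>_. B"]
  by (simp add: PiE_insert_eq sum.reindex sum.cartesian_product o_def case_prod_unfold)

text \<open>The agreement condition determines an extensional function completely, so only one
  summand survives.\<close>

lemma sum_PiE_agree:
  assumes "finite R" "finite B" "\<And>x. x \<in> R \<Longrightarrow> g x \<in> B"
  shows "(\<Sum>f\<in>R \<rightarrow>\<^sub>E B. if \<forall>x\<in>R. g x = f x then Q f else (0::complex)) = Q (restrict g R)"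
proof -
  have *: "(\<forall>x\<in>R. g x = f x) \<longleftrightarrow> f = restrict g R" if "f \<in> R \<rightarrow>\<^sub>E B" for f
  proof
    assume "\<forall>x\<in>R. g x = f x"
    then show "f = restrict g R" using that by (intro PiE_ext[of f R "\<lambda>_. B"]) (auto simp: assms(3))
  qed simp
  have "(\<Sum>f\<in>R \<rightarrow>\<^sub>E B. if \<forall>x\<in>R. g x = f x then Q f else 0)
      = (\<Sum>f\<in>R \<rightarrow>\<^sub>E B. if f = restrict g R then Q f else 0)"
    by (intro sum.cong) (simp_all add: *)
  also have "\<dots> = Q (restrict g R)"
    using assms by (simp add: finite_PiE)
  finally show ?thesis .
qed

text \<open>Exchanging the indices shows that the sum equals its own negative. Filling the diagonal
  with zeros first makes the index set a square, so that the sums can be swapped.\<close>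

lemma sum_off_diagonal_antisym:
  fixes F :: "'i \<Rightarrow> 'i \<Rightarrow> complex"
  assumes "finite A" "\<And>i j. i \<in> A \<Longrightarrow> j \<in> A \<Longrightarrow> i \<noteq> j \<Longrightarrow> F i j = - F j i"
  shows "(\<Sum>i\<in>A. \<Sum>j\<in>A - {i}. F i j) = 0"
proof -
  let ?G = "\<lambda>i j. if i = j then 0 else F i j"
  have eq: "(\<Sum>i\<in>A. \<Sum>j\<in>A - {i}. F i j) = (\<Sum>i\<in>A. \<Sum>j\<in>A. ?G i j)"
    using assms(1) by (intro sum.cong sum.mono_neutral_cong_left) auto
  have "(\<Sum>i\<in>A. \<Sum>j\<in>A. ?G i j) = (\<Sum>j\<in>A. \<Sum>i\<in>A. ?G i j)" by (rule sum.swap)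
  also have "\<dots> = (\<Sum>j\<in>A. \<Sum>i\<in>A. - ?G j i)"
    by (intro sum.cong refl) (auto intro: assms(2))
  also have "\<dots> = - (\<Sum>i\<in>A. \<Sum>j\<in>A. ?G i j)" by (simp add: sum_negf)
  finally show ?thesis unfolding eq by simp
qed

definition cube_sign :: "nat set \<Rightarrow> nat \<Rightarrow> complex" where
  "cube_sign s i = (- 1) ^ card {j \<in> s. j < i}"

lemma cube_sign_nonzero [simp]: "cube_sign s i \<noteq> 0"
  by (simp add: cube_sign_def)

text \<open>Inserting the smaller index raises the count for the larger one by one, while inserting
  the larger leaves the count for the smaller unchanged.\<close>

lemma cube_sign_anticommute:
  assumes "finite s" "i \<notin> s" "j \<notin> s" "i \<noteq> j"
  shows "cube_sign s i * cube_sign (insert i s) j = - (cube_sign s j * cube_sign (insert j s) i)"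
proof -
  have *: "cube_sign s p * cube_sign (insert p s) q = - (cube_sign s q * cube_sign (insert q s) p)"
    if "p \<notin> s" "q \<notin> s" "p < q" for p q
  proof -
    have "{x \<in> insert q s. x < p} = {x \<in> s. x < p}" using that by auto
    moreover have "{x \<in> insert p s. x < q} = insert p {x \<in> s. x < q}" using that by auto
    ultimately show ?thesis using that assms(1) by (simp add: cube_sign_def)
  qed
  show ?thesis
  proof (cases "i < j")
    case True
    then show ?thesis using * assms by blast
  next
    case False
    then show ?thesis using *[of j i] assms by simp
  qed
qed

section \<open>Scaled idempotents and color vectors\<close>

locale color_complex = matched_ribbon_graph D alpha sigma vert tw es
  for D :: "'d set" and alpha sigma :: "'d \<Rightarrow> 'd" and vert :: "'d \<Rightarrow> 'v"
    and tw :: "'d \<Rightarrow> bool" and es :: "'d list" +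
  fixes n :: nat
  assumes n_pos: "0 < n"
begin

abbreviation "m \<equiv> half_n n"
abbreviation "coeff \<equiv> cx_coeff D alpha sigma tw es n"
abbreviation "diff \<equiv> cx_diff D alpha sigma tw es n"
abbreviation "basis \<equiv> cx_basis D alpha sigma tw es n"

text \<open>Up to the factor \<open>\<gamma>\<^sub>p\<close>, \<open>\<Sum>\<^sub>k \<zeta>\<^sub>p\<^sup>k x\<^sup>k\<close> is an idempotent of the algebra. The scaling is the one for
  which merge, split and single-cycle maps all multiply by the same \<open>\<tau>\<^sub>p\<close>:
  \<open>n \<gamma>\<^sub>p = \<zeta>\<^sub>p\<^sup>-\<^sup>2\<^sup>m / \<gamma>\<^sub>p = \<surd>n \<zeta>\<^sub>p\<^sup>-\<^sup>m\<close>.\<close>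

definition gamma :: "nat \<Rightarrow> complex" where
  "gamma p = 1 / (complex_of_real (sqrt (real n)) * zeta n p ^ m)"

definition tau :: "nat \<Rightarrow> complex" where
  "tau p = complex_of_real (sqrt (real n)) / zeta n p ^ m"

lemma sqrt_n: "complex_of_real (sqrt (real n)) \<noteq> 0"
  "complex_of_real (sqrt (real n)) * complex_of_real (sqrt (real n)) = of_nat n"
  using n_pos by (simp_all flip: of_real_mult)

lemma gamma_nonzero [simp]: "gamma p \<noteq> 0" and tau_nonzero [simp]: "tau p \<noteq> 0"
  using sqrt_n by (simp_all add: gamma_def tau_def)

lemma merge_scalar: "of_nat n * gamma p = tau p"
  using sqrt_n(1) unfolding gamma_def tau_def sqrt_n(2)[symmetric] by (simp add: field_simps)

lemma split_scalar: "tau p * gamma p = 1 / zeta n p ^ (2 * m)"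
  using sqrt_n by (simp add: gamma_def tau_def field_simps power2_eq_square mult_2_right power_add)

text \<open>Reads a dart coloring on a curve; for compatible colorings the choice does not affect
  the value.\<close>

definition rep :: "'d set \<Rightarrow> 'd" where "rep C = (SOME x. x \<in> C)"

definition factor :: "('d \<Rightarrow> nat) \<Rightarrow> 'd set \<Rightarrow> nat \<Rightarrow> complex" where
  "factor \<phi> C k = gamma (\<phi> (rep C)) * zeta n (\<phi> (rep C)) ^ k"

text \<open>The tensor product, over the curves of \<open>s\<close>, of the scaled idempotents
  selected by \<phi>, written out in the monomial basis.\<close>

definition color_vec :: "nat set \<Rightarrow> ('d \<Rightarrow> nat) \<Rightarrow> nat set \<times> ('d set \<Rightarrow> nat) \<Rightarrow> complex" where
  "color_vec s \<phi> = (\<lambda>(t, f). if t = s \<and> f \<in> Cv s \<rightarrow>\<^sub>E {..<n} then (\<Prod>C\<in>Cv s. factor \<phi> C (f C)) else 0)"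

lemma finite_Cv: "finite (Cv s)"
  using finite_D by (simp add: curves_def)

lemma rep_cv:
  assumes "x \<in> X"
  shows "rep (cv s x) \<in> cv s x"
  unfolding rep_def using cv_self[OF assms] by (rule someI)

lemma factor_cv: "compatible s \<phi> \<Longrightarrow> x \<in> X \<Longrightarrow> factor \<phi> (cv s x) k = gamma (\<phi> x) * zeta n (\<phi> x) ^ k"
  using compatible_cv[of s \<phi> "rep (cv s x)" x] rep_cv[of x s] by (simp add: factor_def)

lemma cv_Cv: "x \<in> X \<Longrightarrow> cv s x \<in> Cv s"
  by (auto simp: curves_def)

text \<open>Two curves never turn into two, by \<open>not_both_separated\<close>, so the case where
  \<open>cx_coeff\<close> defaults to zero between adjacent states disappears and merge, split and
  single cycle remain. By \<open>uninvolved_eq\<close> the agreement test can be made on the curves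
  of the source state.\<close>

lemma coeff_insert:
  assumes i: "i < length es" "i \<notin> s"
  shows "coeff (insert i s, g) (s, f) =
    (let A = cv s (a i); B = cv s (b i); A' = cv (insert i s) (a i); B' = cv (insert i s) (b i) in
     if \<forall>C\<in>Cv s - {A, B}. g C = f C then cube_sign s i *
       (if A \<noteq> B then (if g A' = (f A + f B) mod n then 1 else 0)
        else if A' \<noteq> B' then (if (g A' + g B') mod n = (f A + 2 * m) mod n then 1 else 0)
        else (if g A' = (f A + m) mod n then complex_of_real (sqrt (real n)) else 0))
     else 0)"
proof -
  have ex: "\<exists>j<length es. j \<notin> s \<and> insert i s = insert j s" using i by blast
  have the: "(THE j. j < length es \<and> j \<notin> s \<and> insert i s = insert j s) = i"
    using i by (intro the_equality) auto
  have unv: "(\<forall>C\<in>Cv (insert i s). C \<noteq> cv (insert i s) (a i) \<and> C \<noteq> cv (insert i s) (b i) \<longrightarrow> g C = f C)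
      \<longleftrightarrow> (\<forall>C\<in>Cv s - {cv s (a i), cv s (b i)}. g C = f C)"
    unfolding uninvolved_eq[OF i(1), of s "insert i s", simplified] 
    by (simp only: Ball_def Diff_iff insert_iff empty_iff, intro iff_allI, argo)
  show ?thesis
    unfolding cx_coeff_def Let_def prod.case the unv cube_sign_def
    using ex not_both_separated[OF i]
    by (cases "cv s (a i) = cv s (b i)"; cases "cv (insert i s) (a i) = cv (insert i s) (b i)") simp_all
qed

text \<open>Every summand whose exponents differ from \<open>g\<close> on an uninvolved curve vanishes, so only a sum
  over the exponents of the one or two curves through \<open>a i\<close> and \<open>b i\<close> remains.\<close>

lemma diff_color_vec_coordinate:
  assumes i: "i < length es" "i \<notin> s" and \<phi>: "compatible s \<phi>" "\<phi> \<in> X \<rightarrow> {..<n}"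
    and g: "g \<in> Cv (insert i s) \<rightarrow>\<^sub>E {..<n}"
  shows "(\<Sum>f\<in>Cv s \<rightarrow>\<^sub>E {..<n}. coeff (insert i s, g) (s, f) * (\<Prod>C\<in>Cv s. factor \<phi> C (f C)))
    = (if \<phi> (a i) = \<phi> (b i) then cube_sign s i * tau (\<phi> (a i)) * (\<Prod>C\<in>Cv (insert i s). factor \<phi> C (g C)) else 0)"
proof -
  let ?t = "insert i s"
  define A B A' B' where AB: "A = cv s (a i)" "B = cv s (b i)" "A' = cv ?t (a i)" "B' = cv ?t (b i)"
  define R where "R = Cv s - {A, B}"
  have X: "a i \<in> X" "b i \<in> X" using ends_X[OF i(1)] by blast+
  have R': "R = Cv ?t - {A', B'}"
    using uninvolved_eq[OF i(1), of s ?t] unfolding R_def AB by simp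
  have "A \<in> Cv s" "B \<in> Cv s" "A' \<in> Cv ?t" "B' \<in> Cv ?t"
    using cv_Cv X by (simp_all add: AB)
  then have Cs: "Cv s = insert A (insert B R)" and Ct: "Cv ?t = insert A' (insert B' R)"
    using R_def R' by blast+
  have nin: "A \<notin> R" "B \<notin> R" "A' \<notin> R" "B' \<notin> R"
    using R_def R' by blast+
  have fR: "finite R" using finite_Cv by (simp add: R_def)
  have gR: "\<And>C. C \<in> R \<Longrightarrow> g C \<in> {..<n}" using g Ct by auto
  have gAB: "g A' < n" "g B' < n" using g Ct by auto
  define u v where uv: "u = \<phi> (a i)" "v = \<phi> (b i)"
  have uvn: "u < n" "v < n" using \<phi>(2) X by (auto simp: uv)
  have fA: "factor \<phi> A k = gamma u * zeta n u ^ k" and fB: "factor \<phi> B k = gamma v * zeta n v ^ k" for k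
    using factor_cv[OF \<phi>(1)] X by (auto simp: AB uv)
  \<comment> \<open>Only for \<open>u = v\<close> is \<phi> compatible with the new state; then its
    factors on the new curves can be read off at \<open>a i\<close> and \<open>b i\<close>.\<close>
  have fAB': "factor \<phi> A' k = gamma u * zeta n u ^ k" "factor \<phi> B' k = gamma v * zeta n v ^ k"
    if "u = v" for k
    using factor_cv[of ?t \<phi>] compatible_insert[OF \<phi>(1) i] X that by (auto simp: AB uv)
  define H where "H = (\<Prod>C\<in>R. factor \<phi> C (g C))"
  have "(\<Prod>C\<in>R. factor \<phi> C (restrict g R C)) = H" unfolding H_def by (rule prod.cong) auto
  then have agree: "(\<Sum>f\<in>R \<rightarrow>\<^sub>E {..<n}. if \<forall>C\<in>R. g C = f C then x * (\<Prod>C\<in>R. factor \<phi> C (f C)) else 0) = x * H" for x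
    using sum_PiE_agree[OF fR finite_lessThan gR, where Q = "\<lambda>f. x * (\<Prod>C\<in>R. factor \<phi> C (f C))"] by simp
  define W where "W f = (if A \<noteq> B then (if g A' = (f A + f B) mod n then 1 else 0)
        else if A' \<noteq> B' then (if (g A' + g B') mod n = (f A + 2 * m) mod n then 1 else 0)
        else (if g A' = (f A + m) mod n then complex_of_real (sqrt (real n)) else 0))" for f
  have coeffW: "coeff (?t, g) (s, f) = (if \<forall>C\<in>R. g C = f C then cube_sign s i * W f else 0)" for f
    unfolding coeff_insert[OF i] Let_def W_def R_def AB by (rule refl)
  define Q where "Q f = (if \<forall>C\<in>R. g C = f C then W f * (\<Prod>C\<in>Cv s. factor \<phi> C (f C)) else 0)" for f
  have "(\<Sum>f\<in>Cv s \<rightarrow>\<^sub>E {..<n}. coeff (?t, g) (s, f) * (\<Prod>C\<in>Cv s. factor \<phi> C (f C)))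
      = cube_sign s i * (\<Sum>f\<in>Cv s \<rightarrow>\<^sub>E {..<n}. Q f)"
    unfolding sum_distrib_left coeffW Q_def by (intro sum.cong) auto
  moreover have "(\<Sum>f\<in>Cv s \<rightarrow>\<^sub>E {..<n}. Q f)
      = (if u = v then tau u * (\<Prod>C\<in>Cv ?t. factor \<phi> C (g C)) else 0)"
  proof (cases "A = B")
    case False
    then have one: "A' = B'" using not_both_separated[OF i] by (auto simp: AB)
    have AnB: "A \<notin> insert B R" using False nin by simp
    have Q_upd: "Q (f(B := l, A := k)) = (if \<forall>C\<in>R. g C = f C
        then (if g A' = (k + l) mod n then 1 else 0) * factor \<phi> A k * factor \<phi> B l * (\<Prod>C\<in>R. factor \<phi> C (f C)) else 0)"
      for f k l
    proof -
      have "(\<forall>C\<in>R. g C = (f(B := l, A := k)) C) \<longleftrightarrow> (\<forall>C\<in>R. g C = f C)"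
        using nin by (auto simp: fun_upd_apply)
      moreover have "W (f(B := l, A := k)) = (if g A' = (k + l) mod n then 1 else 0)"
        using False by (simp add: W_def)
      moreover have "(\<Prod>C\<in>R. factor \<phi> C ((f(B := l, A := k)) C)) = (\<Prod>C\<in>R. factor \<phi> C (f C))"
        using nin by (intro prod.cong) auto
      then have "(\<Prod>C\<in>Cv s. factor \<phi> C ((f(B := l, A := k)) C))
          = factor \<phi> A k * (factor \<phi> B l * (\<Prod>C\<in>R. factor \<phi> C (f C)))"
        unfolding Cs using fR AnB nin False by (simp del: fun_upd_apply) simp
      ultimately show ?thesis unfolding Q_def by (simp only: mult.assoc)
    qed
    have "(\<Sum>f\<in>Cv s \<rightarrow>\<^sub>E {..<n}. Q f) = (\<Sum>k<n. \<Sum>l<n. \<Sum>f\<in>R \<rightarrow>\<^sub>E {..<n}. Q (f(B := l, A := k)))"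
      unfolding Cs sum_PiE_insert[OF AnB] sum_PiE_insert[OF nin(2)] by (rule refl)
    also have "\<dots> = (\<Sum>k<n. \<Sum>l<n. (if g A' = (k + l) mod n then 1 else 0) * factor \<phi> A k * factor \<phi> B l * H)"
      unfolding Q_upd agree by (rule refl)
    \<comment> \<open>Merge: for fixed \<open>k\<close> the exponent \<open>l\<close> is forced
      modulo \<open>n\<close>. What remains is a geometric sum over \<open>k\<close> that vanishes
      for \<open>u \<noteq> v\<close>, the counterpart of distinct idempotents having product
      zero.\<close>
    also have "\<dots> = (\<Sum>k<n. gamma u * gamma v * H * zeta n u ^ k *
        (\<Sum>l<n. if g A' mod n = (l + k) mod n then zeta n v ^ l else 0))"
      unfolding sum_distrib_left fA fB using gAB by (intro sum.cong) (auto simp: add.commute)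
    also have "\<dots> = gamma u * gamma v * H * zeta n v ^ g A' * (\<Sum>k<n. (zeta n u / zeta n v) ^ k)"
      unfolding sum_zeta_shift[OF n_pos] sum_distrib_left by (intro sum.cong) (auto simp: power_divide)
    also have "\<dots> = (if u = v then tau u * (gamma u * zeta n u ^ g A' * H) else 0)"
      unfolding zeta_orthogonality[OF n_pos uvn] merge_scalar[symmetric] by simp
    also have "\<dots> = (if u = v then tau u * (\<Prod>C\<in>Cv ?t. factor \<phi> C (g C)) else 0)"
      unfolding Ct H_def using one nin fR fAB' by simp
    finally show ?thesis .
  next
    case True
    \<comment> \<open>Both arcs lie on one curve, so compatibility makes their colors equal.\<close>
    then have "b i \<in> cv s (a i)"
      using cv_self[OF X(2), of s] by (simp only: AB)
    then have uv_eq: "u = v"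
      unfolding uv using compatible_cv[OF \<phi>(1)] by metis
    define V where "V k = (if A' \<noteq> B' then (if (g A' + g B') mod n = (k + 2 * m) mod n then 1 else 0)
        else (if g A' = (k + m) mod n then complex_of_real (sqrt (real n)) else 0))" for k
    have Q_upd: "Q (f(A := k)) = (if \<forall>C\<in>R. g C = f C
        then V k * factor \<phi> A k * (\<Prod>C\<in>R. factor \<phi> C (f C)) else 0)" for f k
    proof -
      have "(\<forall>C\<in>R. g C = (f(A := k)) C) \<longleftrightarrow> (\<forall>C\<in>R. g C = f C)"
        using nin by (auto simp: fun_upd_apply)
      moreover have "W (f(A := k)) = V k"
        using True by (simp add: W_def V_def)
      moreover have "(\<Prod>C\<in>R. factor \<phi> C ((f(A := k)) C)) = (\<Prod>C\<in>R. factor \<phi> C (f C))"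
        using nin by (intro prod.cong) auto
      then have "(\<Prod>C\<in>Cv s. factor \<phi> C ((f(A := k)) C)) = factor \<phi> A k * (\<Prod>C\<in>R. factor \<phi> C (f C))"
        unfolding Cs True[symmetric] using fR nin by (simp del: fun_upd_apply) simp
      ultimately show ?thesis unfolding Q_def by (simp only: mult.assoc)
    qed
    have "(\<Sum>f\<in>Cv s \<rightarrow>\<^sub>E {..<n}. Q f) = (\<Sum>k<n. \<Sum>f\<in>R \<rightarrow>\<^sub>E {..<n}. Q (f(A := k)))"
      unfolding Cs True[symmetric] insert_absorb2 sum_PiE_insert[OF nin(1)] by (rule refl)
    also have "\<dots> = (\<Sum>k<n. V k * factor \<phi> A k * H)"
      unfolding Q_upd agree by (rule refl)
    also have "\<dots> = tau u * (\<Prod>C\<in>Cv ?t. factor \<phi> C (g C))"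
    proof (cases "A' = B'")
      case one: True
      have "(\<Sum>k<n. V k * factor \<phi> A k * H) = (\<Sum>k<n. complex_of_real (sqrt (real n)) * gamma u * H *
          (if g A' mod n = (k + m) mod n then zeta n u ^ k else 0))"
        unfolding fA V_def using gAB one by (intro sum.cong) auto
      also have "\<dots> = tau u * (gamma u * zeta n u ^ g A' * H)"
        unfolding sum_distrib_left[symmetric] sum_zeta_shift[OF n_pos] tau_def by simp
      also have "\<dots> = tau u * (\<Prod>C\<in>Cv ?t. factor \<phi> C (g C))"
        unfolding Ct H_def using one nin fR fAB'[OF uv_eq] by simp
      finally show ?thesis .
    next
      case two: False
      have "(\<Sum>k<n. V k * factor \<phi> A k * H) = (\<Sum>k<n. gamma u * H *
          (if (g A' + g B') mod n = (k + 2 * m) mod n then zeta n u ^ k else 0))"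
        unfolding fA V_def using two by (intro sum.cong) auto
      \<comment> \<open>Split: the source curve supplies one factor \<open>gamma u\<close>, the two
        target curves need two; \<open>split_scalar\<close> provides the second together with
        \<open>tau u\<close>.\<close>
      also have "\<dots> = (tau u * gamma u) * (gamma u * zeta n u ^ (g A' + g B') * H)"
        unfolding sum_distrib_left[symmetric] sum_zeta_shift[OF n_pos] split_scalar by simp
      also have "\<dots> = tau u * (\<Prod>C\<in>Cv ?t. factor \<phi> C (g C))"
        unfolding Ct H_def using two nin fR fAB'[OF uv_eq] by (simp add: power_add uv_eq)
      finally show ?thesis .
    qed
    finally show ?thesis using uv_eq by simp
  qed
  ultimately show ?thesis by (simp add: uv)
qed

section \<open>The differential on color vectors\<close>

definition colorings :: "nat set \<Rightarrow> ('d \<Rightarrow> nat) set" where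
  "colorings s = {\<phi> \<in> X \<rightarrow>\<^sub>E {..<n}. compatible s \<phi>}"

text \<open>The edges whose smoothing can be switched while a compatible coloring stays compatible,
  by \<open>compatible_insert\<close> and \<open>compatible_remove\<close>. The set depends on the
  coloring alone.\<close>

definition monochromatic :: "('d \<Rightarrow> nat) \<Rightarrow> nat set" where
  "monochromatic \<phi> = {i. i < length es \<and> \<phi> (a i) = \<phi> (b i)}"

definition color_basis :: "nat \<Rightarrow> (nat set \<times> ('d \<Rightarrow> nat)) set" where
  "color_basis k = {(s, \<phi>). s \<subseteq> {..<length es} \<and> card s = k \<and> \<phi> \<in> colorings s}"

lemma finite_basis: "finite (basis k)"
proof -
  have "basis k \<subseteq> Sigma (Pow {..<length es}) (\<lambda>s. Cv s \<rightarrow>\<^sub>E {..<n})"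
    by (auto simp: cx_basis_def)
  moreover have "finite (Sigma (Pow {..<length es}) (\<lambda>s. Cv s \<rightarrow>\<^sub>E {..<n}))"
    by (intro finite_SigmaI finite_PiE finite_Cv) auto
  ultimately show ?thesis by (rule finite_subset)
qed

lemma finite_monochromatic: "finite (monochromatic \<phi>)"
  by (simp add: monochromatic_def)

lemma color_vec_chains:
  assumes "s \<subseteq> {..<length es}" "card s = k"
  shows "color_vec s \<phi> \<in> chains D alpha sigma tw es n k"
  using assms by (auto simp: chains_def color_vec_def cx_basis_def)

lemma diff_chains: "diff k v \<in> chains D alpha sigma tw es n (Suc k)"
  by (simp add: chains_def cx_diff_def)

lemma chains_eq_span: "chains D alpha sigma tw es n k = cvs.span (delta ` basis k)"
  unfolding chains_def span_delta[OF finite_basis] by (rule refl)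

lemma diff_add: "diff k (v + w) = diff k v + diff k w"
  by (auto simp: cx_diff_def fun_eq_iff distrib_left sum.distrib)

lemma diff_scale: "diff k (cscale r v) = cscale r (diff k v)"
  by (auto simp: cx_diff_def cscale_def fun_eq_iff sum_distrib_left mult_ac intro!: sum.cong)

lemma diff_sum:
  assumes "finite A"
  shows "diff k (\<Sum>x\<in>A. cscale (r x) (v x)) = (\<Sum>x\<in>A. cscale (r x) (diff k (v x)))"
proof -
  have "diff k 0 = 0" using diff_add[of k 0 0] by simp
  with assms show ?thesis
    by (induction A rule: finite_induct) (simp_all add: diff_add diff_scale)
qed

lemma sum_fun_apply: "(\<Sum>x\<in>A. F x) y = (\<Sum>x\<in>A. F x y)" for F :: "'i \<Rightarrow> 'b \<Rightarrow> complex"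
  by (induction A rule: infinite_finite_induct) auto

text \<open>Each target state is reached by at most one inserted index, so coefficients can be
  compared state by state using \<open>diff_color_vec_coordinate\<close>. Every term keeps \<phi>:
  this is the splitting of the complex by dart colorings.\<close>

lemma diff_color_vec:
  assumes s: "s \<subseteq> {..<length es}" "card s = k" and \<phi>: "\<phi> \<in> colorings s"
  shows "diff k (color_vec s \<phi>) = (\<Sum>i\<in>monochromatic \<phi> - s.
    cscale (cube_sign s i * tau (\<phi> (a i))) (color_vec (insert i s) \<phi>))" (is "_ = ?R")
proof
  fix y :: "nat set \<times> ('d set \<Rightarrow> nat)"
  obtain t g where y: "y = (t, g)" by (cases y)
  have \<phi>': "compatible s \<phi>" "\<phi> \<in> X \<rightarrow> {..<n}" using \<phi> by (auto simp: colorings_def)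
  have fs: "finite s" using s(1) finite_subset by blast
  have R: "?R y = (\<Sum>i\<in>monochromatic \<phi> - s.
      cube_sign s i * tau (\<phi> (a i)) * color_vec (insert i s) \<phi> y)"
    by (simp add: sum_fun_apply cscale_def)
  show "diff k (color_vec s \<phi>) y = ?R y"
  proof (cases "y \<in> basis (Suc k)")
    case False
    have "color_vec (insert i s) \<phi> y = 0" if "i \<in> monochromatic \<phi> - s" for i
      using False that s fs by (auto simp: y color_vec_def cx_basis_def monochromatic_def)
    then show ?thesis unfolding R using False by (simp add: cx_diff_def)
  next
    case True
    then have g: "g \<in> Cv t \<rightarrow>\<^sub>E {..<n}" by (auto simp: y cx_basis_def)
    have "diff k (color_vec s \<phi>) y = (\<Sum>x\<in>basis k. coeff y x * color_vec s \<phi> x)"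
      using True by (simp add: cx_diff_def)
    also have "\<dots> = (\<Sum>x\<in>Pair s ` (Cv s \<rightarrow>\<^sub>E {..<n}). coeff y x * color_vec s \<phi> x)"
      by (rule sum.mono_neutral_right[OF finite_basis]) (use s in \<open>auto simp: cx_basis_def color_vec_def split: if_splits\<close>)
    also have "\<dots> = (\<Sum>f\<in>Cv s \<rightarrow>\<^sub>E {..<n}. coeff (t, g) (s, f) * color_vec s \<phi> (s, f))"
      by (subst sum.reindex) (auto simp: inj_on_def y)
    also have "\<dots> = (\<Sum>f\<in>Cv s \<rightarrow>\<^sub>E {..<n}. coeff (t, g) (s, f) * (\<Prod>C\<in>Cv s. factor \<phi> C (f C)))"
      by (intro sum.cong) (simp_all add: color_vec_def)
    also have "\<dots> = ?R y"
    proof (cases "\<exists>i<length es. i \<notin> s \<and> t = insert i s")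
      case True
      then obtain i where i: "i < length es" "i \<notin> s" "t = insert i s" by blast
      have "color_vec (insert j s) \<phi> y = 0" if "j \<in> monochromatic \<phi> - s - {i}" for j
      proof -
        have "t \<noteq> insert j s" using that i by blast
        then show ?thesis by (simp add: y color_vec_def)
      qed
      then have "?R y = (\<Sum>j\<in>(monochromatic \<phi> - s) \<inter> {i}.
          cube_sign s j * tau (\<phi> (a j)) * color_vec (insert j s) \<phi> y)"
        unfolding R using finite_monochromatic by (intro sum.mono_neutral_right) auto
      also have "\<dots> = (if \<phi> (a i) = \<phi> (b i) then cube_sign s i * tau (\<phi> (a i)) * color_vec t \<phi> y else 0)"
        using i by (auto simp: monochromatic_def)
      finally show ?thesis
        using diff_color_vec_coordinate[OF i(1,2) \<phi>', of g] g by (simp add: y color_vec_def i(3))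
    next
      case False
      then have "coeff (t, g) (s, f) = 0" for f
        unfolding cx_coeff_def Let_def prod.case by (rule if_not_P)
      moreover have "color_vec (insert j s) \<phi> y = 0" if "j \<in> monochromatic \<phi> - s" for j
        using that False by (auto simp: y color_vec_def monochromatic_def)
      ultimately show ?thesis unfolding R by simp
    qed
    finally show ?thesis .
  qed
qed

lemma colorings_insert:
  assumes "\<phi> \<in> colorings s" "i \<in> monochromatic \<phi> - s"
  shows "\<phi> \<in> colorings (insert i s)"
  using assms compatible_insert[of s \<phi> i] by (simp add: colorings_def monochromatic_def)

text \<open>Two edges can be inserted in either order. The resulting states and the products of
  \<open>tau\<close> agree, while the cube signs are opposite, so the terms cancel in pairs.\<close>

lemma diff_diff_color_vec:
  assumes s: "s \<subseteq> {..<length es}" "card s = k" and \<phi>: "\<phi> \<in> colorings s"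
  shows "diff (Suc k) (diff k (color_vec s \<phi>)) = 0"
proof
  fix y
  let ?A = "monochromatic \<phi> - s"
  let ?r = "\<lambda>s i. cube_sign s i * tau (\<phi> (a i))"
  have fs: "finite s" using s(1) finite_subset by blast
  have "diff (Suc k) (color_vec (insert i s) \<phi>)
      = (\<Sum>j\<in>?A - {i}. cscale (?r (insert i s) j) (color_vec (insert j (insert i s)) \<phi>))"
    if i: "i \<in> ?A" for i
  proof -
    have A: "monochromatic \<phi> - insert i s = ?A - {i}" by blast
    have "insert i s \<subseteq> {..<length es}" "card (insert i s) = Suc k"
      using i s fs by (auto simp: monochromatic_def)
    then show ?thesis using colorings_insert[OF \<phi> i] unfolding A[symmetric] by (rule diff_color_vec)
  qed
  then have dd: "diff (Suc k) (diff k (color_vec s \<phi>)) = (\<Sum>i\<in>?A. cscale (?r s i)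
      (\<Sum>j\<in>?A - {i}. cscale (?r (insert i s) j) (color_vec (insert j (insert i s)) \<phi>)))"
    unfolding diff_color_vec[OF assms] diff_sum[OF finite_Diff[OF finite_monochromatic]]
    by (intro sum.cong) auto
  have "diff (Suc k) (diff k (color_vec s \<phi>)) y = (\<Sum>i\<in>?A. \<Sum>j\<in>?A - {i}.
      ?r s i * ?r (insert i s) j * color_vec (insert j (insert i s)) \<phi> y)"
    unfolding dd by (simp add: sum_fun_apply cscale_def sum_distrib_left mult.assoc)
  also have "\<dots> = 0"
  proof (rule sum_off_diagonal_antisym)
    fix i j assume ij: "i \<in> ?A" "j \<in> ?A" "i \<noteq> j"
    have swap: "(p * q) * (u * v) = (p * u) * (q * v)" for p q u v :: complex by simp
    have "?r s i * ?r (insert i s) j = cube_sign s i * cube_sign (insert i s) j * (tau (\<phi> (a i)) * tau (\<phi> (a j)))"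
      by (rule swap)
    also have "\<dots> = - (cube_sign s j * cube_sign (insert j s) i) * (tau (\<phi> (a j)) * tau (\<phi> (a i)))"
      using cube_sign_anticommute[OF fs, of i j] ij by (simp add: mult.commute)
    also have "\<dots> = - (?r s j * ?r (insert j s) i)"
      unfolding mult_minus_left by (rule arg_cong[where f = uminus], rule swap)
    finally show "?r s i * ?r (insert i s) j * color_vec (insert j (insert i s)) \<phi> y
        = - (?r s j * ?r (insert j s) i * color_vec (insert i (insert j s)) \<phi> y)"
      unfolding insert_commute[of j i s] by (simp only: mult_minus_left)
  qed (simp add: finite_monochromatic)
  finally show "diff (Suc k) (diff k (color_vec s \<phi>)) y = 0 y" by simp
qed

section \<open>Curve colorings as dart colorings, and Fourier inversion\<close>

definition lift :: "nat set \<Rightarrow> ('d set \<Rightarrow> nat) \<Rightarrow> 'd \<Rightarrow> nat" where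
  "lift s \<psi> = (\<lambda>x\<in>X. \<psi> (cv s x))"

lemma rep_Cv:
  assumes "C \<in> Cv s"
  shows "rep C \<in> X" "cv s (rep C) = C"
proof -
  obtain x where x: "x \<in> X" "C = cv s x" using assms by (auto simp: curves_def)
  then show "rep C \<in> X" "cv s (rep C) = C"
    using rep_cv[OF x(1), of s] cv_subset[of s x] cv_cong[OF x(1), of "rep C" s] by blast+
qed

lemma lift_rep: "C \<in> Cv s \<Longrightarrow> lift s \<psi> (rep C) = \<psi> C"
  using rep_Cv[of C s] by (simp add: lift_def)

lemma link_cv: "(x, y) \<in> link s \<Longrightarrow> cv s x = cv s y"
  using cv_eq_iff cv_closed[of x s x y] cv_self link_X by metis

lemma compatible_lift: "compatible s (lift s \<psi>)"
proof -
  have "lift s \<psi> x = lift s \<psi> y" if "(x, y) \<in> link s" for x y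
    using link_cv[OF that] link_X[OF that] by (simp add: lift_def)
  then show ?thesis unfolding compatible_def by blast
qed

text \<open>A compatible dart coloring is constant on curves, so its values at representatives
  recover the curve coloring. Exponents and colors both range over \<open>{..<n}\<close>, hence this
  also matches monomials with colorings in number.\<close>

lemma bij_lift: "bij_betw (lift s) (Cv s \<rightarrow>\<^sub>E {..<n}) (colorings s)"
proof (rule bij_betw_byWitness[where f' = "\<lambda>\<phi>. \<lambda>C\<in>Cv s. \<phi> (rep C)"])
  show "\<forall>\<psi>\<in>Cv s \<rightarrow>\<^sub>E {..<n}. (\<lambda>C\<in>Cv s. lift s \<psi> (rep C)) = \<psi>"
  proof
    fix \<psi> assume \<psi>: "\<psi> \<in> Cv s \<rightarrow>\<^sub>E {..<n}"
    show "(\<lambda>C\<in>Cv s. lift s \<psi> (rep C)) = \<psi>"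
      by (rule extensionalityI[of _ "Cv s"]) (use \<psi> in \<open>auto simp: lift_rep PiE_iff\<close>)
  qed
  show "\<forall>\<phi>\<in>colorings s. lift s (\<lambda>C\<in>Cv s. \<phi> (rep C)) = \<phi>"
  proof
    fix \<phi> assume "\<phi> \<in> colorings s"
    then have \<phi>: "\<phi> \<in> extensional X" "compatible s \<phi>" by (auto simp: colorings_def PiE_iff)
    show "lift s (\<lambda>C\<in>Cv s. \<phi> (rep C)) = \<phi>"
    proof (rule extensionalityI[OF _ \<phi>(1)])
      fix x assume x: "x \<in> X"
      show "lift s (\<lambda>C\<in>Cv s. \<phi> (rep C)) x = \<phi> x"
        using x cv_Cv[OF x, of s] compatible_cv[OF \<phi>(2) rep_cv[OF x]] by (simp add: lift_def)
    qed (simp add: lift_def)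
  qed
  show "lift s ` (Cv s \<rightarrow>\<^sub>E {..<n}) \<subseteq> colorings s"
  proof
    fix \<phi> assume "\<phi> \<in> lift s ` (Cv s \<rightarrow>\<^sub>E {..<n})"
    then obtain \<psi> where \<psi>: "\<phi> = lift s \<psi>" "\<psi> \<in> Cv s \<rightarrow>\<^sub>E {..<n}" by blast
    then have "\<psi> (cv s x) \<in> {..<n}" if "x \<in> X" for x using PiE_mem cv_Cv that by metis
    then have "\<phi> \<in> X \<rightarrow>\<^sub>E {..<n}" unfolding \<psi>(1) lift_def by (rule restrict_PiE_iff[THEN iffD2, OF ballI])
    then show "\<phi> \<in> colorings s" using compatible_lift by (simp add: colorings_def \<psi>(1))
  qed
  show "(\<lambda>\<phi>. \<lambda>C\<in>Cv s. \<phi> (rep C)) ` colorings s \<subseteq> Cv s \<rightarrow>\<^sub>E {..<n}"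
  proof
    fix \<psi> assume "\<psi> \<in> (\<lambda>\<phi>. \<lambda>C\<in>Cv s. \<phi> (rep C)) ` colorings s"
    then obtain \<phi> where \<phi>: "\<psi> = (\<lambda>C\<in>Cv s. \<phi> (rep C))" "\<phi> \<in> X \<rightarrow>\<^sub>E {..<n}"
      by (auto simp: colorings_def)
    then have "\<phi> (rep C) \<in> {..<n}" if "C \<in> Cv s" for C using PiE_mem rep_Cv(1) that by metis
    then show "\<psi> \<in> Cv s \<rightarrow>\<^sub>E {..<n}" unfolding \<phi>(1) by (rule restrict_PiE_iff[THEN iffD2, OF ballI])
  qed
qed

lemma card_color_basis: "card (color_basis k) = card (basis k)"
proof -
  let ?S = "{s. s \<subseteq> {..<length es} \<and> card s = k}"
  have "color_basis k = Sigma ?S colorings" "basis k = Sigma ?S (\<lambda>s. Cv s \<rightarrow>\<^sub>E {..<n})"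
    by (auto simp: color_basis_def cx_basis_def)
  moreover have "finite ?S" by (rule finite_subset[of _ "Pow {..<length es}"]) auto
  moreover have "finite (Cv s \<rightarrow>\<^sub>E {..<n})" for s by (intro finite_PiE finite_Cv) auto
  moreover have "finite (colorings s)" for s
    using bij_betw_finite[OF bij_lift] calculation(4) by blast
  ultimately show ?thesis
    by (simp add: card_SigmaI bij_betw_same_card[OF bij_lift])
qed

lemma finite_color_basis: "finite (color_basis k)"
proof -
  have "finite (X \<rightarrow>\<^sub>E {..<n})" using finite_D by (intro finite_PiE) auto
  then have "finite (Pow {..<length es} \<times> (X \<rightarrow>\<^sub>E {..<n}))" by simp
  moreover have "color_basis k \<subseteq> Pow {..<length es} \<times> (X \<rightarrow>\<^sub>E {..<n})"
    by (auto simp: color_basis_def colorings_def)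
  ultimately show ?thesis using finite_subset by blast
qed

text \<open>Fourier inversion performed on all tensor factors at once.\<close>

lemma delta_in_span_color_vec:
  assumes f: "f \<in> Cv s \<rightarrow>\<^sub>E {..<n}"
  shows "delta (s, f) \<in> cvs.span (color_vec s ` colorings s)"
proof -
  let ?P = "Cv s \<rightarrow>\<^sub>E {..<n}"
  \<comment> \<open>One inversion coefficient per curve: \<open>gamma\<close> undoes the scaling of
    the idempotent, \<open>of_nat n\<close> normalizes orthogonality, and the inverse power of
    \<open>zeta\<close> selects the exponent \<open>f C\<close>.\<close>
  define r where "r \<psi> = (\<Prod>C\<in>Cv s. 1 / (of_nat n * gamma (\<psi> C) * zeta n (\<psi> C) ^ f C))" for \<psi>
  have "delta (s, f) = (\<Sum>\<psi>\<in>?P. cscale (r \<psi>) (color_vec s (lift s \<psi>)))"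
  proof
    fix y :: "nat set \<times> ('d set \<Rightarrow> nat)"
    obtain t g where y: "y = (t, g)" by (cases y)
    show "delta (s, f) y = (\<Sum>\<psi>\<in>?P. cscale (r \<psi>) (color_vec s (lift s \<psi>))) y"
    proof (cases "t = s \<and> g \<in> ?P")
      case False
      then have "color_vec s \<phi> y = 0" for \<phi> unfolding y color_vec_def prod.case by (rule if_not_P)
      moreover have "y \<noteq> (s, f)" using False f y by blast
      ultimately show ?thesis by (simp add: delta_def sum_fun_apply cscale_def)
    next
      case True
      have "(\<Sum>\<psi>\<in>?P. cscale (r \<psi>) (color_vec s (lift s \<psi>))) y
          = (\<Sum>\<psi>\<in>?P. \<Prod>C\<in>Cv s. (zeta n (\<psi> C) ^ g C / zeta n (\<psi> C) ^ f C) / of_nat n)"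
        unfolding sum_fun_apply
      proof (rule sum.cong[OF refl])
        fix \<psi> assume "\<psi> \<in> ?P"
        have "cscale (r \<psi>) (color_vec s (lift s \<psi>)) y = r \<psi> * (\<Prod>C\<in>Cv s. gamma (\<psi> C) * zeta n (\<psi> C) ^ g C)"
          using True by (simp add: y cscale_def color_vec_def factor_def lift_rep)
        also have "\<dots> = (\<Prod>C\<in>Cv s. (zeta n (\<psi> C) ^ g C / zeta n (\<psi> C) ^ f C) / of_nat n)"
          unfolding r_def prod.distrib[symmetric] by (intro prod.cong) auto
        finally show "cscale (r \<psi>) (color_vec s (lift s \<psi>)) y
          = (\<Prod>C\<in>Cv s. (zeta n (\<psi> C) ^ g C / zeta n (\<psi> C) ^ f C) / of_nat n)" .
      qed
      \<comment> \<open>Colors of different curves vary independently, so the sum over colorings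
        factors into one-curve sums.\<close>
      also have "\<dots> = (\<Prod>C\<in>Cv s. \<Sum>p<n. (zeta n p ^ g C / zeta n p ^ f C) / of_nat n)"
        by (rule prod_sum_PiE[symmetric, OF finite_Cv]) simp
      also have "\<dots> = (\<Prod>C\<in>Cv s. if g C = f C then 1 else 0)"
      proof (rule prod.cong[OF refl])
        fix C assume "C \<in> Cv s"
        then have "g C < n" "f C < n" using True f by auto
        have "(\<Sum>p<n. (zeta n p ^ g C / zeta n p ^ f C) / of_nat n)
            = (\<Sum>p<n. (zeta n (g C) / zeta n (f C)) ^ p) / of_nat n"
          by (simp add: sum_divide_distrib power_divide zeta_swap[of n _ "g C"] zeta_swap[of n _ "f C"])
        also have "\<dots> = (if g C = f C then 1 else 0)"
          unfolding zeta_orthogonality[OF n_pos \<open>g C < n\<close> \<open>f C < n\<close>] using n_pos by simp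
        finally show "(\<Sum>p<n. (zeta n p ^ g C / zeta n p ^ f C) / of_nat n) = (if g C = f C then 1 else 0)" .
      qed
      also have "\<dots> = (if g = f then 1 else 0)"
      proof (cases "g = f")
        case False
        then obtain C where "C \<in> Cv s" "g C \<noteq> f C" using True f PiE_ext by metis
        then show ?thesis using False finite_Cv by (auto intro!: prod_zero)
      qed simp
      finally show ?thesis using True by (simp add: y delta_def)
    qed
  qed
  moreover have "lift s \<psi> \<in> colorings s" if "\<psi> \<in> ?P" for \<psi>
    using that bij_lift[of s] by (auto simp: bij_betw_def)
  ultimately show ?thesis
    by (simp add: cvs.span_sum cvs.span_scale cvs.span_base)
qed

subsection \<open>Homology\<close>

text \<open>It is determined by the coloring and not by the state, so switching its smoothing does
  not move it. It is consulted only when a monochromatic edge exists.\<close>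

definition pivot :: "('d \<Rightarrow> nat) \<Rightarrow> nat" where
  "pivot \<phi> = Min (monochromatic \<phi>)"

definition proper_part :: "nat \<Rightarrow> (nat set \<times> ('d \<Rightarrow> nat)) set" where
  "proper_part k = {(s, \<phi>) \<in> color_basis k. monochromatic \<phi> = {}}"

definition source_part :: "nat \<Rightarrow> (nat set \<times> ('d \<Rightarrow> nat)) set" where
  "source_part k = {(s, \<phi>) \<in> color_basis k. monochromatic \<phi> \<noteq> {} \<and> pivot \<phi> \<notin> s}"

definition target_part :: "nat \<Rightarrow> (nat set \<times> ('d \<Rightarrow> nat)) set" where
  "target_part k = {(s, \<phi>) \<in> color_basis k. monochromatic \<phi> \<noteq> {} \<and> pivot \<phi> \<in> s}"

text \<open>A state containing the pivot receives the boundary of its partner without the pivot.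
  With this choice the differential sends every vector of the family to zero or to another vector of
  it; \<open>card s - 1\<close> is the partner's degree.\<close>

definition adapted_vec :: "nat set \<times> ('d \<Rightarrow> nat) \<Rightarrow> nat set \<times> ('d set \<Rightarrow> nat) \<Rightarrow> complex" where
  "adapted_vec = (\<lambda>(s, \<phi>). if monochromatic \<phi> \<noteq> {} \<and> pivot \<phi> \<in> s
    then diff (card s - 1) (color_vec (s - {pivot \<phi>}) \<phi>) else color_vec s \<phi>)"

lemma pivot_monochromatic: "monochromatic \<phi> \<noteq> {} \<Longrightarrow> pivot \<phi> \<in> monochromatic \<phi>"
  unfolding pivot_def by (rule Min_in[OF finite_monochromatic])

lemma color_basis_split: "color_basis k = (proper_part k \<union> target_part k) \<union> source_part k"
  by (auto simp: proper_part_def source_part_def target_part_def)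

lemma parts_disjoint: "(proper_part k \<union> target_part k) \<inter> source_part k = {}"
  "proper_part k \<inter> target_part k = {}"
  by (auto simp: proper_part_def source_part_def target_part_def)

lemma finite_parts: "finite (proper_part k)" "finite (target_part k)" "finite (source_part k)"
  using finite_color_basis[of k] unfolding color_basis_split[of k] by simp_all

lemma color_basis_finite_state: "(s, \<phi>) \<in> color_basis k \<Longrightarrow> finite s"
  by (auto simp: color_basis_def intro: finite_subset)

lemma insert_color_basis:
  assumes "(s, \<phi>) \<in> color_basis k" "i \<in> monochromatic \<phi>" "i \<notin> s"
  shows "(insert i s, \<phi>) \<in> color_basis (Suc k)"
  using assms colorings_insert[of \<phi> s i] color_basis_finite_state[OF assms(1)]
  by (auto simp: color_basis_def monochromatic_def)

lemma remove_color_basis: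
  assumes "(s, \<phi>) \<in> color_basis k" "i \<in> monochromatic \<phi>" "i \<in> s"
  shows "(s - {i}, \<phi>) \<in> color_basis (k - 1)"
  using assms compatible_remove[of s \<phi> i]
  by (auto simp: color_basis_def monochromatic_def colorings_def)

definition toggle :: "nat set \<times> ('d \<Rightarrow> nat) \<Rightarrow> nat set \<times> ('d \<Rightarrow> nat)" where
  "toggle = (\<lambda>(s, \<phi>). (insert (pivot \<phi>) s, \<phi>))"

lemma toggle_image: "toggle ` source_part k = target_part (Suc k)"
proof (intro equalityI subsetI)
  fix x assume "x \<in> toggle ` source_part k"
  then obtain s \<phi> where x: "x = (insert (pivot \<phi>) s, \<phi>)" "(s, \<phi>) \<in> color_basis k"
    "monochromatic \<phi> \<noteq> {}" "pivot \<phi> \<notin> s"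
    by (auto simp: source_part_def toggle_def)
  then show "x \<in> target_part (Suc k)"
    using insert_color_basis[OF x(2) pivot_monochromatic[OF x(3)] x(4)] by (simp add: target_part_def)
next
  fix x assume "x \<in> target_part (Suc k)"
  then obtain s \<phi> where x: "x = (s, \<phi>)" "(s, \<phi>) \<in> color_basis (Suc k)"
    "monochromatic \<phi> \<noteq> {}" "pivot \<phi> \<in> s"
    by (auto simp: target_part_def)
  have "(s - {pivot \<phi>}, \<phi>) \<in> source_part k"
    using remove_color_basis[OF x(2) pivot_monochromatic[OF x(3)] x(4)] x(3) by (simp add: source_part_def)
  moreover have "x = toggle (s - {pivot \<phi>}, \<phi>)"
    using x(1,4) by (auto simp: toggle_def)
  ultimately show "x \<in> toggle ` source_part k" by blast
qed

lemma inj_toggle: "inj_on toggle (source_part k)"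
  by (rule inj_onI) (auto simp: toggle_def source_part_def insert_ident)

lemma adapted_vec_source:
  assumes "x \<in> source_part k"
  shows "diff k (adapted_vec x) = adapted_vec (toggle x)"
proof -
  obtain s \<phi> where x: "x = (s, \<phi>)" "(s, \<phi>) \<in> color_basis k"
    "monochromatic \<phi> \<noteq> {}" "pivot \<phi> \<notin> s"
    using assms by (auto simp: source_part_def)
  have "finite s" "card s = k"
    using color_basis_finite_state[OF x(2)] x(2) by (simp_all add: color_basis_def)
  then show ?thesis using x by (simp add: adapted_vec_def toggle_def)
qed

text \<open>With no monochromatic edge the sum for the differential is empty; target vectors are
  boundaries, killed by the square of the differential.\<close>

lemma adapted_vec_cycle:
  assumes "x \<in> proper_part k \<union> target_part k"
  shows "diff k (adapted_vec x) = 0"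
proof -
  obtain s \<phi> where x: "x = (s, \<phi>)" "(s, \<phi>) \<in> color_basis k"
    using assms by (auto simp: proper_part_def target_part_def)
  then have s: "s \<subseteq> {..<length es}" "card s = k" "\<phi> \<in> colorings s"
    by (auto simp: color_basis_def)
  show ?thesis
  proof (cases "monochromatic \<phi> = {}")
    case True
    then show ?thesis using diff_color_vec[OF s] by (simp add: x adapted_vec_def)
  next
    case False
    then have p: "pivot \<phi> \<in> s" using assms by (auto simp: x proper_part_def target_part_def)
    \<comment> \<open>The state contains the pivot, so \<open>k\<close> is positive and the
      truncated subtraction is exact.\<close>
    have k: "k = Suc (k - 1)"
      using p s(2) color_basis_finite_state[OF x(2)] by (cases k) auto
    have "(s - {pivot \<phi>}, \<phi>) \<in> color_basis (k - 1)"
      by (rule remove_color_basis[OF x(2) pivot_monochromatic[OF False] p])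
    then have "diff (Suc (k - 1)) (diff (k - 1) (color_vec (s - {pivot \<phi>}) \<phi>)) = 0"
      using diff_diff_color_vec by (simp add: color_basis_def)
    then show ?thesis using False p s(2) k by (simp add: x adapted_vec_def)
  qed
qed

lemma adapted_vec_chains:
  assumes "x \<in> color_basis k"
  shows "adapted_vec x \<in> chains D alpha sigma tw es n k"
proof -
  obtain s \<phi> where x: "x = (s, \<phi>)" by (cases x)
  then have s: "s \<subseteq> {..<length es}" "card s = k" using assms by (auto simp: color_basis_def)
  show ?thesis
  proof (cases "monochromatic \<phi> \<noteq> {} \<and> pivot \<phi> \<in> s")
    case True
    then have "k = Suc (k - 1)"
      using s finite_subset[OF s(1)] by (cases k) auto
    then show ?thesis using True diff_chains[of "k - 1"] s(2) by (simp add: x adapted_vec_def)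
  next
    case False
    then have "adapted_vec x = color_vec s \<phi>" unfolding x adapted_vec_def prod.case by (rule if_not_P)
    then show ?thesis using color_vec_chains[OF s] by simp
  qed
qed

text \<open>The differential of a source vector contains its toggled partner with nonzero coefficient, and
  all its other terms are again source vectors, since inserting another edge does not affect the pivot.\<close>

lemma color_vec_in_span_adapted:
  assumes "(s, \<phi>) \<in> color_basis k"
  shows "color_vec s \<phi> \<in> cvs.span (adapted_vec ` color_basis k)"
proof (cases "monochromatic \<phi> \<noteq> {} \<and> pivot \<phi> \<in> s")
  case False
  then have "adapted_vec (s, \<phi>) = color_vec s \<phi>" by (auto simp: adapted_vec_def)
  then show ?thesis using assms cvs.span_base by (metis imageI)
next
  case True
  let ?p = "pivot \<phi>"
  define s0 where "s0 = s - {?p}"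
  let ?r = "\<lambda>i. cube_sign s0 i * tau (\<phi> (a i))"
  have p: "?p \<in> monochromatic \<phi>" using True pivot_monochromatic by blast
  have s0: "(s0, \<phi>) \<in> color_basis (k - 1)" unfolding s0_def
    using remove_color_basis[OF assms p] True by blast
  have s: "insert ?p s0 = s" using True by (auto simp: s0_def)
  have k: "Suc (k - 1) = k"
    using assms True color_basis_finite_state[OF assms] by (cases k) (auto simp: color_basis_def)
  define E where "E = monochromatic \<phi> - s0 - {?p}"
  have fE: "finite E" by (simp add: E_def finite_monochromatic)
  have "adapted_vec (s, \<phi>) = diff (k - 1) (color_vec s0 \<phi>)"
    using True assms by (auto simp: adapted_vec_def s0_def color_basis_def)
  also have "\<dots> = (\<Sum>i\<in>monochromatic \<phi> - s0. cscale (?r i) (color_vec (insert i s0) \<phi>))"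
    using s0 by (intro diff_color_vec) (auto simp: color_basis_def)
  also have "\<dots> = cscale (?r ?p) (color_vec s \<phi>) + (\<Sum>i\<in>E. cscale (?r i) (color_vec (insert i s0) \<phi>))"
    unfolding E_def s[symmetric] by (rule sum.remove) (use p in \<open>auto simp: finite_monochromatic s0_def\<close>)
  finally have eq: "cscale (?r ?p) (color_vec s \<phi>)
      = adapted_vec (s, \<phi>) - (\<Sum>i\<in>E. cscale (?r i) (color_vec (insert i s0) \<phi>))"
    by simp
  have "color_vec (insert i s0) \<phi> \<in> adapted_vec ` color_basis k" if "i \<in> E" for i
  proof -
    have i: "i \<in> monochromatic \<phi>" "i \<notin> s0" "i \<noteq> ?p" using that by (auto simp: E_def)
    have "(insert i s0, \<phi>) \<in> color_basis k"
      using insert_color_basis[OF s0 i(1,2)] by (simp only: k)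
    moreover have "adapted_vec (insert i s0, \<phi>) = color_vec (insert i s0) \<phi>"
      using i by (simp add: adapted_vec_def s0_def)
    ultimately show ?thesis by (metis imageI)
  qed
  then have "cscale (?r ?p) (color_vec s \<phi>) \<in> cvs.span (adapted_vec ` color_basis k)"
    unfolding eq using assms
    by (intro cvs.span_diff cvs.span_sum cvs.span_scale) (auto intro: cvs.span_base)
  then have "cscale (inverse (?r ?p)) (cscale (?r ?p) (color_vec s \<phi>)) \<in> cvs.span (adapted_vec ` color_basis k)"
    by (rule cvs.span_scale)
  moreover have "?r ?p \<noteq> 0" by simp
  then have "inverse (?r ?p) * ?r ?p = 1" by (rule left_inverse)
  ultimately show ?thesis by (simp only: cvs.scale_scale cvs.scale_one)
qed

text \<open>Monomials are combinations of color vectors by Fourier inversion, and color vectors are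
  combinations of adapted ones.\<close>

lemma span_adapted: "cvs.span (adapted_vec ` color_basis k) = chains D alpha sigma tw es n k"
proof (rule antisym)
  show "cvs.span (adapted_vec ` color_basis k) \<subseteq> chains D alpha sigma tw es n k"
    unfolding chains_eq_span
    by (rule cvs.span_minimal) (use adapted_vec_chains chains_eq_span in auto)
  have "delta ` basis k \<subseteq> cvs.span (adapted_vec ` color_basis k)"
  proof
    fix v assume "v \<in> delta ` basis k"
    then obtain s f where sf: "v = delta (s, f)" "s \<subseteq> {..<length es}" "card s = k" "f \<in> Cv s \<rightarrow>\<^sub>E {..<n}"
      by (auto simp: cx_basis_def)
    have "color_vec s ` colorings s \<subseteq> cvs.span (adapted_vec ` color_basis k)"
      using color_vec_in_span_adapted sf by (auto simp: color_basis_def)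
    then have "cvs.span (color_vec s ` colorings s) \<subseteq> cvs.span (adapted_vec ` color_basis k)"
      by (rule cvs.span_minimal) simp
    then show "v \<in> cvs.span (adapted_vec ` color_basis k)"
      using delta_in_span_color_vec[OF sf(4)] sf(1) by blast
  qed
  then show "chains D alpha sigma tw es n k \<subseteq> cvs.span (adapted_vec ` color_basis k)"
    unfolding chains_eq_span by (rule cvs.span_minimal) simp
qed

text \<open>Independence comes from counting: a family that spans the monomials and has equally many
  members is a basis.\<close>

lemma adapted_basis:
  "inj_on adapted_vec (color_basis k)" "cvs.independent (adapted_vec ` color_basis k)"
proof -
  have "delta ` basis k \<subseteq> cvs.span (adapted_vec ` color_basis k)"
    unfolding span_adapted chains_eq_span by (rule cvs.span_superset)
  moreover have "card (color_basis k) = card (delta ` basis k :: (_ \<Rightarrow> complex) set)"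
    by (simp add: card_color_basis card_image[OF inj_delta])
  ultimately show "inj_on adapted_vec (color_basis k)" "cvs.independent (adapted_vec ` color_basis k)"
    using cvs.spanning_family_inj_independent[OF finite_color_basis independent_delta[OF finite_basis]] by blast+
qed

text \<open>On the source part the differential acts as \<open>toggle\<close> on indices, so the
  images form part of the adapted basis one degree higher.\<close>

lemma diff_adapted_source:
  "inj_on (diff k \<circ> adapted_vec) (source_part k)" "cvs.independent ((diff k \<circ> adapted_vec) ` source_part k)"
proof -
  have eq: "(diff k \<circ> adapted_vec) x = (adapted_vec \<circ> toggle) x" if "x \<in> source_part k" for x
    using adapted_vec_source[OF that] by simp
  have sub: "toggle ` source_part k \<subseteq> color_basis (Suc k)"
    unfolding toggle_image by (auto simp: color_basis_split)
  have inj: "inj_on (adapted_vec \<circ> toggle) (source_part k)"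
    by (rule comp_inj_on[OF inj_toggle inj_on_subset[OF adapted_basis(1) sub]])
  show "inj_on (diff k \<circ> adapted_vec) (source_part k)"
  proof (rule inj_onI)
    fix x y assume x: "x \<in> source_part k" and y: "y \<in> source_part k"
      and "(diff k \<circ> adapted_vec) x = (diff k \<circ> adapted_vec) y"
    then have "(adapted_vec \<circ> toggle) x = (adapted_vec \<circ> toggle) y"
      by (simp only: eq)
    then show "x = y" by (rule inj_onD[OF inj _ x y])
  qed
  have "(diff k \<circ> adapted_vec) ` source_part k = adapted_vec ` toggle ` source_part k"
    unfolding image_comp by (rule image_cong[OF refl]) (rule eq)
  also have "\<dots> \<subseteq> adapted_vec ` color_basis (Suc k)" using sub by (rule image_mono)
  finally show "cvs.independent ((diff k \<circ> adapted_vec) ` source_part k)"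
    using adapted_basis(2) cvs.independent_mono by blast
qed

section \<open>Dimensions of cycles, boundaries and homology\<close>

lemma dim_cycles:
  "cvs.dim {v \<in> chains D alpha sigma tw es n k. diff k v = 0} = card (proper_part k) + card (target_part k)"
proof -
  have "cvs.dim {v \<in> cvs.span (adapted_vec ` ((proper_part k \<union> target_part k) \<union> source_part k)). diff k v = 0}
      = card (proper_part k \<union> target_part k)"
    by (rule cvs.dim_kernel_of_family)
      (use finite_parts parts_disjoint(1) adapted_basis[of k] diff_adapted_source diff_add diff_scale adapted_vec_cycle
       in \<open>simp_all flip: color_basis_split\<close>)
  then show ?thesis
    by (simp add: span_adapted card_Un_disjoint finite_parts parts_disjoint(2) flip: color_basis_split)
qed

lemma dim_boundaries:
  "cvs.dim (diff k ` chains D alpha sigma tw es n k) = card (target_part (Suc k))"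
proof -
  have "cvs.dim (diff k ` cvs.span (adapted_vec ` ((proper_part k \<union> target_part k) \<union> source_part k)))
      = card (source_part k)"
    by (rule cvs.dim_image_of_family)
      (use finite_parts diff_adapted_source diff_add diff_scale adapted_vec_cycle in simp_all)
  then show ?thesis
    by (simp add: span_adapted card_image[OF inj_toggle] flip: color_basis_split toggle_image)
qed

text \<open>Boundaries arriving from the previous degree account exactly for the target part of the
  cycles. In degree zero nothing is subtracted, but the only state is empty and contains no pivot,
  so the target part is empty too.\<close>

lemma homology_dim_eq: "homology_dim D alpha sigma tw es n k = card (proper_part k)"
proof (cases k)
  case 0
  have "target_part 0 = {}"
  proof (rule equals0I)
    fix x assume "x \<in> target_part 0"
    then obtain s \<phi> where x: "(s, \<phi>) \<in> color_basis 0" "pivot \<phi> \<in> s"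
      by (auto simp: target_part_def)
    then show False using color_basis_finite_state[OF x(1)] by (simp add: color_basis_def)
  qed
  then show ?thesis using dim_cycles[of 0] 0 by (simp add: homology_dim_def)
next
  case (Suc j)
  then show ?thesis using dim_cycles[of k] dim_boundaries[of j] by (simp add: homology_dim_def)
qed

section \<open>Comparison with the color bracket\<close>

definition proper_colorings :: "nat set \<Rightarrow> ('d \<Rightarrow> nat) set" where
  "proper_colorings s = {\<phi> \<in> colorings s. monochromatic \<phi> = {}}"

text \<open>Passes between colors \<open>1..n\<close> on curves and \<open>0..n-1\<close> on darts;
  the condition that arcs differ becomes absence of monochromatic edges.\<close>

lemma N_state_eq: "N_state D alpha sigma tw es n s = card (proper_colorings s)"
proof -
  let ?N = "{col \<in> Cv s \<rightarrow>\<^sub>E {1..n}. \<forall>i<length es. col (cv s (a i)) \<noteq> col (cv s (b i))}"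
  let ?f = "\<lambda>\<phi>. \<lambda>C\<in>Cv s. Suc (\<phi> (rep C))" and ?g = "\<lambda>col. lift s (\<lambda>C. col C - 1)"
  have "bij_betw ?f (proper_colorings s) ?N"
  proof (rule bij_betw_byWitness[where f' = ?g])
    have f_cv: "?f \<phi> (cv s x) = Suc (\<phi> x)" if "\<phi> \<in> colorings s" "x \<in> X" for \<phi> x
      using that cv_Cv[OF that(2)] compatible_cv[OF _ rep_cv[OF that(2)], of s \<phi>]
      by (simp add: colorings_def)
    show "\<forall>\<phi>\<in>proper_colorings s. ?g (?f \<phi>) = \<phi>"
    proof
      fix \<phi> assume "\<phi> \<in> proper_colorings s"
      then have \<phi>: "\<phi> \<in> colorings s" by (simp add: proper_colorings_def)
      show "?g (?f \<phi>) = \<phi>"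
      proof (rule extensionalityI)
        fix x assume "x \<in> X"
        then show "?g (?f \<phi>) x = \<phi> x" using f_cv[OF \<phi>] by (simp add: lift_def)
      qed (use \<phi> in \<open>auto simp: lift_def colorings_def PiE_iff\<close>)
    qed
    show "\<forall>col\<in>?N. ?f (?g col) = col"
    proof
      fix col assume "col \<in> ?N"
      then have col: "col \<in> Cv s \<rightarrow>\<^sub>E {1..n}" by simp
      show "?f (?g col) = col"
      proof (rule extensionalityI)
        fix C assume C: "C \<in> Cv s"
        \<comment> \<open>Colors start at 1, so \<open>Suc\<close> undoes the truncated subtraction
          in \<open>?g\<close>.\<close>
        then have "0 < col C" using col by (force simp: PiE_iff)
        then show "?f (?g col) C = col C" using C by (simp add: lift_rep)
      qed (use col in \<open>auto simp: PiE_iff\<close>)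
    qed
    show "?f ` proper_colorings s \<subseteq> ?N"
    proof
      fix col assume "col \<in> ?f ` proper_colorings s"
      then obtain \<phi> where \<phi>: "col = ?f \<phi>" "\<phi> \<in> colorings s" "monochromatic \<phi> = {}"
        by (auto simp: proper_colorings_def)
      have "Suc (\<phi> (rep C)) \<in> {1..n}" if "C \<in> Cv s" for C
        using \<phi>(2) rep_Cv(1)[OF that] by (auto simp: colorings_def PiE_iff Suc_le_eq)
      then have "col \<in> Cv s \<rightarrow>\<^sub>E {1..n}"
        unfolding \<phi>(1) by (rule restrict_PiE_iff[THEN iffD2, OF ballI])
      moreover have "col (cv s (a i)) \<noteq> col (cv s (b i))" if "i < length es" for i
        using \<phi>(3) that unfolding \<phi>(1) f_cv[OF \<phi>(2) ends_X(1)[OF that]] f_cv[OF \<phi>(2) ends_X(2)[OF that]]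
        by (auto simp: monochromatic_def)
      ultimately show "col \<in> ?N" by simp
    qed
    show "?g ` ?N \<subseteq> proper_colorings s"
    proof
      fix \<phi> assume "\<phi> \<in> ?g ` ?N"
      then obtain col where col: "\<phi> = ?g col" "col \<in> Cv s \<rightarrow>\<^sub>E {1..n}"
        "\<And>i. i < length es \<Longrightarrow> col (cv s (a i)) \<noteq> col (cv s (b i))"
        by blast
      have pos: "1 \<le> col C \<and> col C \<le> n" if "C \<in> Cv s" for C
        using col(2) that by (auto simp: PiE_iff)
      have "col (cv s x) - 1 \<in> {..<n}" if "x \<in> X" for x
        using pos[OF cv_Cv[OF that, of s]] by auto
      then have "\<phi> \<in> X \<rightarrow>\<^sub>E {..<n}"
        unfolding col(1) lift_def by (rule restrict_PiE_iff[THEN iffD2, OF ballI])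
      then have "\<phi> \<in> colorings s" by (simp add: colorings_def col(1) compatible_lift)
      moreover have "\<phi> (a i) \<noteq> \<phi> (b i)" if i: "i < length es" for i
        using col(3)[OF i] ends_X[OF i] pos[OF cv_Cv[OF ends_X(1)[OF i], of s]]
          pos[OF cv_Cv[OF ends_X(2)[OF i], of s]]
        unfolding col(1) lift_def by (auto simp del: Diff_iff)
      ultimately show "\<phi> \<in> proper_colorings s" by (auto simp: proper_colorings_def monochromatic_def)
    qed
  qed
  then show ?thesis unfolding N_state_def by (rule bij_betw_same_card[symmetric])
qed

lemma finite_proper_colorings: "finite (proper_colorings s)"
proof -
  have "finite (X \<rightarrow>\<^sub>E {..<n})" using finite_D by (intro finite_PiE) auto
  moreover have "proper_colorings s \<subseteq> X \<rightarrow>\<^sub>E {..<n}" by (auto simp: proper_colorings_def colorings_def)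
  ultimately show ?thesis using finite_subset by blast
qed

text \<open>Grouping the states by cardinality turns the bracket into a sum over homological
  degrees, each equal to the size of the proper part.\<close>

theorem total_face_color_eq: "total_face_color D alpha sigma tw es n = color_bracket D alpha sigma tw es n"
proof -
  have "card (proper_part k) = (\<Sum>s\<in>{s \<in> Pow {..<length es}. card s = k}. card (proper_colorings s))" for k
  proof -
    have "proper_part k = Sigma {s \<in> Pow {..<length es}. card s = k} proper_colorings"
      by (auto simp: proper_part_def color_basis_def proper_colorings_def)
    then show ?thesis by (simp add: card_SigmaI finite_proper_colorings)
  qed
  then have "total_face_color D alpha sigma tw es n
      = (\<Sum>k\<le>length es. \<Sum>s\<in>{s \<in> Pow {..<length es}. card s = k}. card (proper_colorings s))"
    by (simp add: total_face_color_def homology_dim_eq)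
  also have "\<dots> = (\<Sum>s\<in>Pow {..<length es}. card (proper_colorings s))"
  proof (rule sum.group)
    show "card ` Pow {..<length es} \<subseteq> {..length es}"
      using card_mono[of "{..<length es}"] by fastforce
  qed simp_all
  also have "\<dots> = color_bracket D alpha sigma tw es n"
    by (simp add: color_bracket_def N_state_eq)
  finally show ?thesis .
qed

end

theorem theorem4p3:
  fixes D :: "'d set" and alpha sigma :: "'d \<Rightarrow> 'd" and vert :: "'d \<Rightarrow> 'v"
    and tw :: "'d \<Rightarrow> bool" and es :: "'d list" and n :: nat
  assumes "perfect_matching_graph D alpha vert sigma tw es"
    and "0 < n"
  shows "total_face_color D alpha sigma tw es n = color_bracket D alpha sigma tw es n"
proof -
  interpret color_complex D alpha sigma vert tw es n
    by unfold_locales (use assms in auto)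
  show ?thesis by (rule total_face_color_eq)
qed

end
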